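(* Let $m\ge1$ and let $G$ be the $(2m+1)$-dimensional Heisenberg group with its Mal'cev basis $(a_1,\dots,a_{2m+1})$. The dimension of Jennings' embedding of $G$ is $2m^2+3m+2$, and the dimension of Nickel's embedding of $G$ (with respect to this Mal'cev basis) is $2m+2$. In particular, the size of the matrices obtained in Jennings' embedding is larger than the size of those obtained in Nickel's embedding.
   Context: For $i<j$, $s_{i,j}=1+e_{i,j}$, where $e_{i,j}$ is the matrix with $(i,j)$ entry $1$ and all other entries $0$. $UT_d(\mathbb Z)$ is the group of upper triangular $d\times d$ integer matrices with all diagonal entries $1$. The $(2m+1)$-dimensional Heisenberg group is the subgroup $G=\langle a_1,\dots,a_{2m+1}\rangle\le UT_{m+2}(\mathbb Z)$ with $a_i=s_{1,i+1}$ for $1\le i\le m$, $a_i=s_{i-m+1,m+2}$ for $m+1\le i\le 2m$, and $a_{2m+1}=s_{1,m+2}$. It has nilpotency class $c=2$, and $(a_1,\dots,a_{2m+1})$ is a Mal'cev basis, meaning every $g\in G$ can be written uniquely as $a_1^{x_1}\cdots a_{2m+1}^{x_{2m+1}}$ with $x_i\in\mathbb Z$ and the subgroups $\langle a_i,\dots,a_{2m+1}\rangle$ form a central series. Jennings' embedding is the matrix representation of $G$ given by the right multiplication action of $G$ on $\mathbb QG/I^{c+1}$, where $c$ is the nilpotency class and $I=\{\sum_g\lambda_g g\in\mathbb QG\mid\sum_g\lambda_g=0\}$ is the augmentation ideal; its dimension is $\dim_{\mathbb Q}(\mathbb QG/I^{c+1})$. Nickel's embedding with respect to a Mal'cev basis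 $(a_1,\dots,a_n)$: $G$ acts on $(\mathbb QG)^*$ (the space of $\mathbb{Q}$-linear maps $\mathbb QG\to\mathbb Q$, identified with functions $G\to\mathbb Q$) by $f^g(h)=f(hg^{-1})$. The coordinate functions are $t_i:G\to\mathbb Z$, $t_i(a_1^{x_1}\cdots a_n^{x_n})=x_i$. The $G$-submodule of $(\mathbb QG)^*$ generated by $t_1,\dots,t_n$ is a finite-dimensional faithful $G$-module, and Nickel's embedding is the resulting unitriangular matrix representation of $G$. Its dimension is the dimension over $\mathbb Q$ of this $G$-submodule. *)

theory Defs
  imports "Jordan_Normal_Form.VS_Connect" "HOL-Algebra.Ideal_Product"
    "HOL-Algebra.QuotRing" "HOL-Algebra.Generated_Groups"
begin

abbreviation QQ :: "rat ring" where
  "QQ \<equiv> class_ring"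

definition unitriangular_group :: "nat \<Rightarrow> int mat monoid" where
  "unitriangular_group d =
    \<lparr>carrier = {A \<in> carrier_mat d d. upper_triangular A \<and> (\<forall>i<d. A $$ (i, i) = 1)},
     monoid.mult = (*), one = 1\<^sub>m d\<rparr>"

text \<open>Matrix positions \<open>(i, j)\<close> are counted from 1 here, as opposed to the library's
  convention for \<open>$$\<close>.\<close>

definition matrix_unit :: "nat \<Rightarrow> nat \<Rightarrow> nat \<Rightarrow> int mat" where
  "matrix_unit d i j = mat d d (\<lambda>(k, l). if Suc k = i \<and> Suc l = j then 1 else 0)"

definition transvection :: "nat \<Rightarrow> nat \<Rightarrow> nat \<Rightarrow> int mat" where
  "transvection d i j = 1\<^sub>m d + matrix_unit d i j"

definition heis_gen :: "nat \<Rightarrow> nat \<Rightarrow> int mat" where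
  "heis_gen m i =
    (if i \<le> m then transvection (m + 2) 1 (i + 1)
     else if i \<le> 2 * m then transvection (m + 2) (i - m + 1) (m + 2)
     else transvection (m + 2) 1 (m + 2))"

definition heis_basis :: "nat \<Rightarrow> int mat list" where
  "heis_basis m = map (heis_gen m) [1..<2 * m + 2]"

definition heisenberg_group :: "nat \<Rightarrow> int mat monoid" where
  "heisenberg_group m = subgroup_generated (unitriangular_group (m + 2)) (set (heis_basis m))"

text \<open>The numbering starts at 0, so \<open>lower_central G k\<close> is the term usually written
  $\gamma_{k+1}(G)$.\<close>

fun lower_central :: "('g, 'b) monoid_scheme \<Rightarrow> nat \<Rightarrow> 'g set" where
  "lower_central G 0 = carrier G"
| "lower_central G (Suc k) =
    generate G (\<Union>x \<in> lower_central G k. \<Union>y \<in> carrier G.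
      {x \<otimes>\<^bsub>G\<^esub> y \<otimes>\<^bsub>G\<^esub> inv\<^bsub>G\<^esub> x \<otimes>\<^bsub>G\<^esub> inv\<^bsub>G\<^esub> y})"

definition nilpotency_class :: "('g, 'b) monoid_scheme \<Rightarrow> nat" where
  "nilpotency_class G = (LEAST c. lower_central G c = {\<one>\<^bsub>G\<^esub>})"

definition group_algebra :: "('g, 'b) monoid_scheme \<Rightarrow> (rat, 'g \<Rightarrow> rat) module" where
  "group_algebra G =
    \<lparr>carrier = {f. finite {x. f x \<noteq> 0} \<and> {x. f x \<noteq> 0} \<subseteq> carrier G},
     monoid.mult = (\<lambda>f g x. \<Sum>y | f y \<noteq> 0. \<Sum>z | g z \<noteq> 0. if y \<otimes>\<^bsub>G\<^esub> z = x then f y * g z else 0),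
     one = (\<lambda>x. of_bool (x = \<one>\<^bsub>G\<^esub>)),
     zero = (\<lambda>x. 0),
     add = (\<lambda>f g x. f x + g x),
     smult = (\<lambda>q f x. q * f x)\<rparr>"

definition group_elem :: "'g \<Rightarrow> 'g \<Rightarrow> rat" where
  "group_elem g = (\<lambda>x. of_bool (x = g))"

definition augmentation_ideal :: "('g, 'b) monoid_scheme \<Rightarrow> ('g \<Rightarrow> rat) set" where
  "augmentation_ideal G = {f \<in> carrier (group_algebra G). (\<Sum>x | f x \<noteq> 0. f x) = 0}"

text \<open>The quotient of an algebra by a two-sided ideal: the factor ring, with scalars acting on
  representatives in the same style as \<^const>\<open>rcoset_mult\<close>.\<close>

definition quotient_algebra :: "(rat, 'a) module \<Rightarrow> 'a set \<Rightarrow> (rat, 'a set) module" where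
  "quotient_algebra A J =
    \<lparr>carrier = carrier (A Quot J),
     monoid.mult = monoid.mult (A Quot J),
     one = one (A Quot J),
     zero = zero (A Quot J),
     add = add (A Quot J),
     smult = (\<lambda>q X. \<Union>x\<in>X. J +>\<^bsub>A\<^esub> (q \<odot>\<^bsub>A\<^esub> x))\<rparr>"

text \<open>\<open>\<rho>\<close> is the representation by \<open>d \<times> d\<close> matrices obtained from a right action of \<open>G\<close> on \<open>V\<close>
  and some ordered basis of \<open>V\<close>. As the action is on the right, the coordinates of the image of
  the \<open>i\<close>-th basis vector form the \<open>i\<close>-th row.\<close>

definition matrix_rep ::
  "('g, 'b) monoid_scheme \<Rightarrow> (rat, 'v) module \<Rightarrow> ('g \<Rightarrow> 'v \<Rightarrow> 'v) \<Rightarrow> nat \<Rightarrow> ('g \<Rightarrow> rat mat) \<Rightarrow> bool"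
where
  "matrix_rep G V act d \<rho> \<longleftrightarrow>
    (\<exists>bs. length bs = d \<and> distinct bs \<and> vectorspace.basis QQ V (set bs) \<and>
      (\<forall>g \<in> carrier G. \<rho> g \<in> carrier_mat d d \<and>
        (\<forall>i<d. act g (bs ! i) = (\<Oplus>\<^bsub>V\<^esub>j \<in> {..<d}. (\<rho> g $$ (i, j)) \<odot>\<^bsub>V\<^esub> (bs ! j)))))"

definition jennings_ideal :: "('g, 'b) monoid_scheme \<Rightarrow> ('g \<Rightarrow> rat) set" where
  "jennings_ideal G =
    augmentation_ideal G [^]\<^bsub>ideals_set (group_algebra G)\<^esub> (nilpotency_class G + 1)"

definition jennings_module :: "('g, 'b) monoid_scheme \<Rightarrow> (rat, ('g \<Rightarrow> rat) set) module" where
  "jennings_module G = quotient_algebra (group_algebra G) (jennings_ideal G)"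

definition jennings_act ::
  "('g, 'b) monoid_scheme \<Rightarrow> 'g \<Rightarrow> ('g \<Rightarrow> rat) set \<Rightarrow> ('g \<Rightarrow> rat) set" where
  "jennings_act G g X =
    X \<otimes>\<^bsub>jennings_module G\<^esub> (jennings_ideal G +>\<^bsub>group_algebra G\<^esub> group_elem g)"

definition jennings_embedding :: "('g, 'b) monoid_scheme \<Rightarrow> nat \<Rightarrow> ('g \<Rightarrow> rat mat) \<Rightarrow> bool" where
  "jennings_embedding G d \<rho> \<longleftrightarrow> matrix_rep G (jennings_module G) (jennings_act G) d \<rho>"

definition malcev_prod :: "('g, 'b) monoid_scheme \<Rightarrow> 'g list \<Rightarrow> int list \<Rightarrow> 'g" where
  "malcev_prod G as xs = foldr (\<lambda>(a, x) p. a [^]\<^bsub>G\<^esub> x \<otimes>\<^bsub>G\<^esub> p) (zip as xs) \<one>\<^bsub>G\<^esub>"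

definition malcev_coords :: "('g, 'b) monoid_scheme \<Rightarrow> 'g list \<Rightarrow> 'g \<Rightarrow> int list" where
  "malcev_coords G as g = (THE xs. length xs = length as \<and> malcev_prod G as xs = g)"

text \<open>The dual of the group algebra, identified with the space of all functions from \<open>G\<close> to the
  rationals (extensional outside the carrier).\<close>

definition dual_module :: "('g, 'b) monoid_scheme \<Rightarrow> (rat, 'g \<Rightarrow> rat) module" where
  "dual_module G = ring.func_space QQ (carrier G)"

definition dual_act :: "('g, 'b) monoid_scheme \<Rightarrow> 'g \<Rightarrow> ('g \<Rightarrow> rat) \<Rightarrow> 'g \<Rightarrow> rat" where
  "dual_act G g f = (\<lambda>h \<in> carrier G. f (h \<otimes>\<^bsub>G\<^esub> inv\<^bsub>G\<^esub> g))"

definition coord_fun :: "('g, 'b) monoid_scheme \<Rightarrow> 'g list \<Rightarrow> nat \<Rightarrow> 'g \<Rightarrow> rat" where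
  "coord_fun G as i = (\<lambda>h \<in> carrier G. of_int (malcev_coords G as h ! i))"

definition nickel_module :: "('g, 'b) monoid_scheme \<Rightarrow> 'g list \<Rightarrow> (rat, 'g \<Rightarrow> rat) module" where
  "nickel_module G as = (dual_module G)\<lparr>carrier :=
    \<Inter>{W. subspace QQ W (dual_module G) \<and>
        (\<forall>g \<in> carrier G. \<forall>f \<in> W. dual_act G g f \<in> W) \<and>
        (\<forall>i < length as. coord_fun G as i \<in> W)}\<rparr>"

text \<open>Any ordered basis of the module is admitted, in particular those in which the matrices are
  unitriangular.\<close>

definition nickel_embedding ::
  "('g, 'b) monoid_scheme \<Rightarrow> 'g list \<Rightarrow> nat \<Rightarrow> ('g \<Rightarrow> rat mat) \<Rightarrow> bool" where
  "nickel_embedding G as d \<rho> \<longleftrightarrow> matrix_rep G (nickel_module G as) (dual_act G) d \<rho>"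

end

theory Submission
  imports Defs "HOL-Library.Function_Algebras"
begin

text \<open>
  A functional on the group algebra kills the cube of the augmentation ideal iff the function
  \<open>F\<close> on \<open>G\<close> inducing it has vanishing third differences; as the cube is a subspace, it is the common
  kernel of these functionals. For such an \<open>F\<close> the polarization \<open>F (g h) - F g - F h + F 1\<close> is
  a homomorphism in each argument and vanishes on commutators, in particular on the last Mal'cev
  generator. Evaluating \<open>F\<close> on \<open>a\<^sub>1\<^bsup>x\<^sub>1\<^esup> \<dots> a\<^sub>n\<^bsup>x\<^sub>n\<^esup>\<close> therefore writes it as a combination of
  \<open>1\<close>, the coordinates, and the \<open>x\<^sub>i (x\<^sub>i - 1) / 2\<close> and \<open>x\<^sub>i x\<^sub>j\<close> with \<open>i < j \<le> 2m\<close>, and this family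
  has an explicit dual family in the group algebra. For Nickel's module, translating the last
  coordinate only adds an affine combination of the others, so the module is spanned by \<open>1\<close>
  and the \<open>2m + 1\<close> coordinates.
\<close>

section \<open>Linear algebra\<close>

text \<open>Non-membership in the cube is awkward to show directly, since its elements are sums of
  products; functionals turn independence and spanning in the quotient into evaluations at group
  elements. The functions that occur are the polynomials of weight at most 2, where the first
  \<open>2 * m\<close> coordinates, being homomorphisms, have weight 1 and the last one has weight
  2: sorting a product feeds products of two coordinates into it. Hence the last coordinate enters
  only linearly, and the count is 1 + (2m + 1) + m(2m + 1), the last summand counting the pairs i
  \<le> j among 2m coordinates. Nickel's module stays linear in size because a translation freezes
  one factor of each such product, which leaves a linear function. Both dimensions are found from a
  family and its dual functionals. The matrices enter only at the end: the argument works with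
  coordinate functions obeying the multiplication law.\<close>

lemma (in vectorspace) dim_dual_family:
  fixes e :: "'i \<Rightarrow> 'c" and \<phi> :: "'i \<Rightarrow> 'c \<Rightarrow> 'a"
  assumes fin: "finite I" and e: "\<And>i. i \<in> I \<Longrightarrow> e i \<in> carrier V"
    and closed: "\<And>i v. i \<in> I \<Longrightarrow> v \<in> carrier V \<Longrightarrow> \<phi> i v \<in> carrier K"
    and add: "\<And>i v w. i \<in> I \<Longrightarrow> v \<in> carrier V \<Longrightarrow> w \<in> carrier V \<Longrightarrow>
      \<phi> i (v \<oplus>\<^bsub>V\<^esub> w) = \<phi> i v \<oplus>\<^bsub>K\<^esub> \<phi> i w"
    and smult: "\<And>i q v. i \<in> I \<Longrightarrow> q \<in> carrier K \<Longrightarrow> v \<in> carrier V \<Longrightarrow>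
      \<phi> i (q \<odot>\<^bsub>V\<^esub> v) = q \<otimes>\<^bsub>K\<^esub> \<phi> i v"
    and dual: "\<And>i j. i \<in> I \<Longrightarrow> j \<in> I \<Longrightarrow> \<phi> i (e j) = (if i = j then \<one>\<^bsub>K\<^esub> else \<zero>\<^bsub>K\<^esub>)"
    and expand: "\<And>v. v \<in> carrier V \<Longrightarrow> (\<Oplus>\<^bsub>V\<^esub>i\<in>I. \<phi> i v \<odot>\<^bsub>V\<^esub> e i) = v"
  shows "fin_dim \<and> dim = card I"
proof -
  \<comment> \<open>The family is indexed, so the basis has \<open>card I\<close> elements only if
    \<open>e\<close> is injective; this follows from duality and 1 \<noteq> 0 in the field.\<close>
  have inj: "inj_on e I"
  proof (rule inj_onI)
    fix i j assume ij: "i \<in> I" "j \<in> I" "e i = e j"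
    have "(if i = j then \<one>\<^bsub>K\<^esub> else \<zero>\<^bsub>K\<^esub>) = \<one>\<^bsub>K\<^esub>"
      using dual[OF ij(1) ij(1)] dual[OF ij(1,2)] ij(3) by simp
    then show "i = j" by (auto split: if_splits)
  qed
  have eC: "e ` I \<subseteq> carrier V" using e by auto
  have zero: "\<phi> i \<zero>\<^bsub>V\<^esub> = \<zero>\<^bsub>K\<^esub>" if "i \<in> I" for i
    using add[OF that, of "\<zero>\<^bsub>V\<^esub>" "\<zero>\<^bsub>V\<^esub>"] closed[OF that, of "\<zero>\<^bsub>V\<^esub>"]
    by (simp add: R.add.r_cancel_one')
  have sum: "\<phi> i (\<Oplus>\<^bsub>V\<^esub>j\<in>J. c j \<odot>\<^bsub>V\<^esub> e j) = (\<Oplus>\<^bsub>K\<^esub>j\<in>J. c j \<otimes>\<^bsub>K\<^esub> \<phi> i (e j))"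
    if "i \<in> I" "finite J" "J \<subseteq> I" "c \<in> J \<rightarrow> carrier K" for i J c
    using that(2-)
  proof (induction J rule: finite_induct)
    case empty then show ?case using zero[OF that(1)] by simp
  next
    case (insert j J)
    then have 1: "(\<Oplus>\<^bsub>V\<^esub>j\<in>insert j J. c j \<odot>\<^bsub>V\<^esub> e j) = c j \<odot>\<^bsub>V\<^esub> e j \<oplus>\<^bsub>V\<^esub> (\<Oplus>\<^bsub>V\<^esub>j\<in>J. c j \<odot>\<^bsub>V\<^esub> e j)"
      using e by (intro M.finsum_insert) (auto simp: Pi_iff)
    have 2: "(\<Oplus>\<^bsub>V\<^esub>j\<in>J. c j \<odot>\<^bsub>V\<^esub> e j) \<in> carrier V"
      using insert.prems e by (intro M.finsum_closed) (auto simp: Pi_iff)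
    have 3: "(\<Oplus>\<^bsub>K\<^esub>j\<in>insert j J. c j \<otimes>\<^bsub>K\<^esub> \<phi> i (e j)) = c j \<otimes>\<^bsub>K\<^esub> \<phi> i (e j) \<oplus>\<^bsub>K\<^esub> (\<Oplus>\<^bsub>K\<^esub>j\<in>J. c j \<otimes>\<^bsub>K\<^esub> \<phi> i (e j))"
      using insert e closed[OF that(1)] by (intro R.finsum_insert) (auto simp: Pi_iff)
    show ?case using insert e
      by (simp add: 1 2 3 add[OF that(1)] smult[OF that(1)])
  qed
  \<comment> \<open>\<open>\<phi> i\<close> reads the coefficient of \<open>e i\<close> off any
    combination. This gives the uniqueness half of \<open>basis_criterion\<close>;
    \<open>expand\<close> gives existence.\<close>
  have coeff: "\<phi> i (\<Oplus>\<^bsub>V\<^esub>j\<in>I. c j \<odot>\<^bsub>V\<^esub> e j) = c i" if "i \<in> I" "c \<in> I \<rightarrow> carrier K" for i c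
  proof -
    have "(\<Oplus>\<^bsub>K\<^esub>j\<in>I. c j \<otimes>\<^bsub>K\<^esub> \<phi> i (e j)) = (\<Oplus>\<^bsub>K\<^esub>j\<in>I. if i = j then c j else \<zero>\<^bsub>K\<^esub>)"
      using that dual by (intro R.finsum_cong') (auto simp: Pi_iff)
    also have "\<dots> = c i"
      using that fin by (intro R.finsum_singleton) auto
    finally show ?thesis using sum[OF that(1) fin _ that(2)] by simp
  qed
  have lin: "lincomb a (e ` I) = (\<Oplus>\<^bsub>V\<^esub>i\<in>I. a (e i) \<odot>\<^bsub>V\<^esub> e i)" if "a \<in> e ` I \<rightarrow> carrier K" for a
    unfolding lincomb_def using inj that e by (intro M.finsum_reindex) (auto simp: Pi_iff)
  have "basis (e ` I)"
    unfolding basis_criterion[OF finite_imageI[OF fin] eC]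
  proof (intro allI impI ex_ex1I)
    fix v assume v: "v \<in> carrier V"
    show "\<exists>a. a \<in> e ` I \<rightarrow>\<^sub>E carrier K \<and> lincomb a (e ` I) = v"
    proof (intro exI conjI)
      let ?a = "\<lambda>w\<in>e ` I. \<phi> (inv_into I e w) v"
      show *: "?a \<in> e ` I \<rightarrow>\<^sub>E carrier K" using closed v inj by auto
      have "lincomb ?a (e ` I) = (\<Oplus>\<^bsub>V\<^esub>i\<in>I. \<phi> i v \<odot>\<^bsub>V\<^esub> e i)"
        using * inj e closed v by (subst lin) (auto intro!: M.finsum_cong')
      then show "lincomb ?a (e ` I) = v" using expand[OF v] by simp
    qed
  next
    fix v a b
    assume "a \<in> e ` I \<rightarrow>\<^sub>E carrier K \<and> lincomb a (e ` I) = v"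
      and "b \<in> e ` I \<rightarrow>\<^sub>E carrier K \<and> lincomb b (e ` I) = v"
    then have a: "a \<in> e ` I \<rightarrow>\<^sub>E carrier K" and b: "b \<in> e ` I \<rightarrow>\<^sub>E carrier K"
      and eq: "lincomb a (e ` I) = lincomb b (e ` I)" by auto
    have Pi: "a \<in> e ` I \<rightarrow> carrier K" "b \<in> e ` I \<rightarrow> carrier K" using a b by auto
    have "a (e i) = b (e i)" if "i \<in> I" for i
      using coeff[OF that, of "\<lambda>i. a (e i)"] coeff[OF that, of "\<lambda>i. b (e i)"] Pi eq
      unfolding lin[OF Pi(1)] lin[OF Pi(2)] by (auto simp: Pi_iff)
    then show "a = b" using a b by (intro PiE_ext[OF a b]) auto
  qed
  then have "fin_dim" "dim = card (e ` I)"
    unfolding fin_dim_def basis_def using fin eC dim_basis[of "e ` I"]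
    by (auto simp: basis_def)
  then show ?thesis using card_image[OF inj] by simp
qed

text \<open>A basis of \<open>J\<close> stays independent after adding \<open>u\<close>, so the
  values 0 on it and 1 at \<open>u\<close> extend to a linear map. The ambient space is the full
  function type, so \<open>\<phi>\<close> is linear without carrier conditions.\<close>

lemma linear_functional_separates:
  fixes J :: "('a \<Rightarrow> rat) set"
  assumes zero: "(\<lambda>x. 0) \<in> J" and add: "\<And>f g. f \<in> J \<Longrightarrow> g \<in> J \<Longrightarrow> (\<lambda>x. f x + g x) \<in> J"
    and scale: "\<And>q f. f \<in> J \<Longrightarrow> (\<lambda>x. q * f x) \<in> J" and u: "u \<notin> J"
  shows "\<exists>\<phi> :: ('a \<Rightarrow> rat) \<Rightarrow> rat. (\<forall>f g. \<phi> (\<lambda>x. f x + g x) = \<phi> f + \<phi> g) \<and>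
    (\<forall>q f. \<phi> (\<lambda>x. q * f x) = q * \<phi> f) \<and> (\<forall>f\<in>J. \<phi> f = 0) \<and> \<phi> u = 1"
proof -
  define s :: "rat \<Rightarrow> ('a \<Rightarrow> rat) \<Rightarrow> 'a \<Rightarrow> rat" where "s = (\<lambda>q f x. q * f x)"
  interpret p: vector_space_pair s "(*) :: rat \<Rightarrow> rat \<Rightarrow> rat"
    by unfold_locales (auto simp: s_def fun_eq_iff algebra_simps)
  have J: "p.vs1.subspace J"
    using zero add scale by (auto intro!: p.vs1.subspaceI simp: plus_fun_def zero_fun_def)
        (simp add: s_def)
  obtain B where B: "B \<subseteq> J" "p.vs1.independent B" "J \<subseteq> p.vs1.span B"
    using p.vs1.basis_exists[of J] by metis
  have spanB: "p.vs1.span B = J"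
    using B J p.vs1.span_minimal by blast
  then have "p.vs1.independent (insert u B)"
    using B(2) u p.vs1.independent_insertI by simp
  then obtain \<phi> where \<phi>: "Vector_Spaces.linear s (*) \<phi>"
      "\<forall>x\<in>insert u B. \<phi> x = of_bool (x = u)"
    using p.linear_independent_extend[of "insert u B" "\<lambda>x. of_bool (x = u)"] by blast
  interpret l: Vector_Spaces.linear s "(*)" \<phi> by (rule \<phi>(1))
  have uB: "u \<notin> B" using u spanB p.vs1.span_base by blast
  show ?thesis
  proof (intro exI[of _ \<phi>] conjI allI ballI)
    show "\<phi> (\<lambda>x. f x + g x) = \<phi> f + \<phi> g" for f g
      using l.add[of f g] by (simp add: plus_fun_def)
    show "\<phi> (\<lambda>x. q * f x) = q * \<phi> f" for q f
      using l.scale[of q f] by (simp add: s_def)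
    show "\<phi> u = 1" using \<phi>(2) by simp
    show "\<phi> f = 0" if "f \<in> J" for f
    proof -
      have "\<phi> x = 0" if "x \<in> B" for x using \<phi>(2) uB that by auto
      with \<open>f \<in> J\<close> show ?thesis
        using p.linear_eq_0_on_span[OF \<phi>(1), of B f] spanB by simp
    qed
  qed
qed

section \<open>The group algebra\<close>

text \<open>The linear extension of \<open>F\<close>, evaluated at a finitely supported
  \<open>f\<close>.\<close>

definition pairing :: "('g \<Rightarrow> rat) \<Rightarrow> ('g \<Rightarrow> rat) \<Rightarrow> rat" where
  "pairing F f = (\<Sum>x | f x \<noteq> 0. f x * F x)"

lemma pairing_superset:
  assumes "finite A" "{x. f x \<noteq> 0} \<subseteq> A"
  shows "pairing F f = (\<Sum>x\<in>A. f x * F x)"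
  unfolding pairing_def using assms by (intro sum.mono_neutral_left) auto

lemma pairing_zero [simp]: "pairing F (\<lambda>x. 0) = 0" "pairing (\<lambda>x. 0) f = 0"
  by (simp_all add: pairing_def)

lemma pairing_cong: "(\<And>x. f x \<noteq> 0 \<Longrightarrow> F x = F' x) \<Longrightarrow> pairing F f = pairing F' f"
  by (auto simp: pairing_def intro: sum.cong)

lemma pairing_add_right:
  assumes "finite {x. f x \<noteq> 0}" "finite {x. g x \<noteq> 0}"
  shows "pairing F (\<lambda>x. f x + g x) = pairing F f + pairing F g"
proof -
  let ?A = "{x. f x \<noteq> 0} \<union> {x. g x \<noteq> 0}"
  have "pairing F (\<lambda>x. f x + g x) = (\<Sum>x\<in>?A. (f x + g x) * F x)"
    using assms by (intro pairing_superset) auto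
  also have "\<dots> = (\<Sum>x\<in>?A. f x * F x) + (\<Sum>x\<in>?A. g x * F x)"
    by (simp add: distrib_right sum.distrib)
  also have "\<dots> = pairing F f + pairing F g"
    using assms by (subst (1 2) pairing_superset[of ?A]) auto
  finally show ?thesis .
qed

lemma pairing_scale_right: "pairing F (\<lambda>x. q * f x) = q * pairing F f"
  by (cases "q = 0") (auto simp: pairing_def sum_distrib_left mult.assoc)

lemma pairing_minus_right:
  assumes "finite {x. f x \<noteq> 0}" "finite {x. g x \<noteq> 0}"
  shows "pairing F (\<lambda>x. f x - g x) = pairing F f - pairing F g"
  using pairing_add_right[of f "\<lambda>x. - 1 * g x" F] pairing_scale_right[of F "- 1" g] assms
  by simp

lemma pairing_add_left: "pairing (\<lambda>x. F x + F' x) f = pairing F f + pairing F' f"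
  by (simp add: pairing_def distrib_left sum.distrib)

lemma pairing_minus_left: "pairing (\<lambda>x. F x - F' x) f = pairing F f - pairing F' f"
  by (simp add: pairing_def right_diff_distrib sum_subtractf)

lemma pairing_scale_left: "pairing (\<lambda>x. q * F x) f = q * pairing F f"
  by (simp add: pairing_def sum_distrib_left mult_ac)

lemma pairing_const: "pairing (\<lambda>x. q) f = q * pairing (\<lambda>x. 1) f"
  using pairing_scale_left[of q "\<lambda>x. 1"] by simp

lemma pairing_sum_left: "pairing (\<lambda>x. \<Sum>i\<in>I. F i x) f = (\<Sum>i\<in>I. pairing (F i) f)"
  unfolding pairing_def by (subst sum.swap) (simp add: sum_distrib_left)

lemma supp_group_elem [simp]: "{x. group_elem g x \<noteq> 0} = {g}"
  by (auto simp: group_elem_def)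

lemma pairing_group_elem [simp]: "pairing F (group_elem g) = F g"
  by (simp add: pairing_def) (simp add: group_elem_def)

lemma pairing_sum_right:
  assumes "\<And>i. i \<in> I \<Longrightarrow> finite {x. f i x \<noteq> 0}"
  shows "pairing F (\<lambda>x. \<Sum>i\<in>I. f i x) = (\<Sum>i\<in>I. pairing F (f i))"
  using assms
proof (induction I rule: infinite_finite_induct)
  case (insert i I)
  have "finite {x. (\<Sum>i\<in>I. f i x) \<noteq> 0}"
    by (rule finite_subset[of _ "\<Union>i\<in>I. {x. f i x \<noteq> 0}"])
      (use insert in \<open>auto dest: sum.not_neutral_contains_not_neutral\<close>)
  with insert show ?case by (simp add: pairing_add_right)
qed auto

lemma pairing_eval: "finite {x. f x \<noteq> 0} \<Longrightarrow> pairing (\<lambda>x. of_bool (x = y)) f = f y"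
  by (auto simp: pairing_def of_bool_def if_distrib cong: if_cong)

text \<open>Indicator functions of points are among the \<open>F\<close>. Identities between
  convolutions can thus be checked after pairing.\<close>

lemma pairing_eqI:
  assumes "finite {x. f x \<noteq> 0}" "finite {x. g x \<noteq> 0}" "\<And>F. pairing F f = pairing F g"
  shows "f = g"
  using pairing_eval[OF assms(1)] pairing_eval[OF assms(2)] assms(3) by (metis ext)

lemma carrier_group_algebra:
  "carrier (group_algebra G) = {f. finite {x. f x \<noteq> 0} \<and> {x. f x \<noteq> 0} \<subseteq> carrier G}"
  by (simp add: group_algebra_def)

lemma group_algebra_simps [simp]:
  "\<zero>\<^bsub>group_algebra G\<^esub> = (\<lambda>x. 0)"
  "\<one>\<^bsub>group_algebra G\<^esub> = group_elem \<one>\<^bsub>G\<^esub>"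
  "f \<oplus>\<^bsub>group_algebra G\<^esub> g = (\<lambda>x. f x + g x)"
  "q \<odot>\<^bsub>group_algebra G\<^esub> f = (\<lambda>x. q * f x)"
  by (simp_all add: group_algebra_def group_elem_def)

lemma augmentation_ideal_eq:
  "augmentation_ideal G = {f \<in> carrier (group_algebra G). pairing (\<lambda>x. 1) f = 0}"
  by (simp add: augmentation_ideal_def pairing_def)

text \<open>The condition says that the linear extension of \<open>F\<close> vanishes on (a - 1)(b -
  1)(c - 1), expanded into eight group elements.\<close>

definition (in group) quadratic :: "('a \<Rightarrow> rat) \<Rightarrow> bool" where
  "quadratic F \<longleftrightarrow> (\<forall>a \<in> carrier G. \<forall>b \<in> carrier G. \<forall>c \<in> carrier G.
    F (a \<otimes> b \<otimes> c) = F (a \<otimes> b) + F (a \<otimes> c) + F (b \<otimes> c) - F a - F b - F c + F \<one>)"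

context group
begin

abbreviation "A \<equiv> group_algebra G"

lemma group_algebra_finite: "f \<in> carrier A \<Longrightarrow> finite {x. f x \<noteq> 0}"
  by (simp add: carrier_group_algebra)

lemma group_algebra_supp: "f \<in> carrier A \<Longrightarrow> f x \<noteq> 0 \<Longrightarrow> x \<in> carrier G"
  by (auto simp: carrier_group_algebra)

lemma group_elem_closed [simp]: "g \<in> carrier G \<Longrightarrow> group_elem g \<in> carrier A"
  by (simp add: carrier_group_algebra)

lemma group_algebra_zero_closed [simp]: "(\<lambda>x. 0) \<in> carrier A"
  by (simp add: carrier_group_algebra)

lemma group_algebra_add_closed [simp]:
  assumes "f \<in> carrier A" "g \<in> carrier A"
  shows "(\<lambda>x. f x + g x) \<in> carrier A"
proof -
  have "{x. f x + g x \<noteq> 0} \<subseteq> {x. f x \<noteq> 0} \<union> {x. g x \<noteq> 0}" by auto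
  with assms show ?thesis
    unfolding carrier_group_algebra by (auto intro: finite_subset)
qed

lemma group_algebra_scale_closed [simp]: "f \<in> carrier A \<Longrightarrow> (\<lambda>x. q * f x) \<in> carrier A"
  by (cases "q = 0") (simp_all add: carrier_group_algebra)

lemma group_algebra_minus_closed [simp]:
  "f \<in> carrier A \<Longrightarrow> g \<in> carrier A \<Longrightarrow> (\<lambda>x. f x - g x) \<in> carrier A"
  using group_algebra_add_closed[of f "\<lambda>x. - 1 * g x"] group_algebra_scale_closed[of g
      "- 1"] by simp

lemma group_algebra_sum_closed:
  "(\<And>i. i \<in> I \<Longrightarrow> f i \<in> carrier A) \<Longrightarrow> (\<lambda>x. \<Sum>i\<in>I. f i x) \<in> carrier A"
  by (induction I rule: infinite_finite_induct) auto

lemma group_algebra_mult: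
  "f \<otimes>\<^bsub>A\<^esub> g = (\<lambda>x. \<Sum>y | f y \<noteq> 0. \<Sum>z | g z \<noteq> 0. f y * g z * of_bool (y \<otimes> z = x))"
  by (simp add: group_algebra_def of_bool_def if_distrib cong: if_cong)

lemma group_algebra_mult_supp:
  "{x. (f \<otimes>\<^bsub>A\<^esub> g) x \<noteq> 0} \<subseteq> (\<lambda>(y, z). y \<otimes> z) ` ({y. f y \<noteq> 0} \<times> {z. g z \<noteq> 0})"
proof
  fix x assume "x \<in> {x. (f \<otimes>\<^bsub>A\<^esub> g) x \<noteq> 0}"
  then have "(\<Sum>y | f y \<noteq> 0. \<Sum>z | g z \<noteq> 0. f y * g z * of_bool (y \<otimes> z = x)) \<noteq> 0"
    by (simp add: group_algebra_mult)
  then obtain y where y: "f y \<noteq> 0" "(\<Sum>z | g z \<noteq> 0. f y * g z * of_bool (y \<otimes> z = x)) \<noteq> 0"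
    by (auto elim: sum.not_neutral_contains_not_neutral)
  then obtain z where "g z \<noteq> 0" "f y * g z * of_bool (y \<otimes> z = x) \<noteq> 0"
    by (auto elim: sum.not_neutral_contains_not_neutral)
  with y show "x \<in> (\<lambda>(y, z). y \<otimes> z) ` ({y. f y \<noteq> 0} \<times> {z. g z \<noteq> 0})"
    by (auto simp: image_def of_bool_def split: if_splits)
qed

lemma group_algebra_mult_closed [simp]:
  assumes "f \<in> carrier A" "g \<in> carrier A"
  shows "f \<otimes>\<^bsub>A\<^esub> g \<in> carrier A"
proof -
  have "finite {x. (f \<otimes>\<^bsub>A\<^esub> g) x \<noteq> 0}"
    by (rule finite_subset[OF group_algebra_mult_supp])
      (use assms in \<open>auto simp: group_algebra_finite\<close>)
  moreover have "{x. (f \<otimes>\<^bsub>A\<^esub> g) x \<noteq> 0} \<subseteq> carrier G"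
    using group_algebra_mult_supp[of f g] group_algebra_supp[OF assms(1)]
      group_algebra_supp[OF assms(2)] by fastforce
  ultimately show ?thesis by (simp add: carrier_group_algebra)
qed

declare group_algebra_finite [simp]

text \<open>A discrete form of Fubini's theorem: summing over the finite image \<open>?B\<close> of
  the pairs of support points, each pair (y, z) meets only x = yz.\<close>

lemma pairing_mult:
  assumes "f \<in> carrier A" "g \<in> carrier A"
  shows "pairing F (f \<otimes>\<^bsub>A\<^esub> g) = pairing (\<lambda>y. pairing (\<lambda>z. F (y \<otimes> z)) g) f"
proof -
  let ?B = "(\<lambda>(y, z). y \<otimes> z) ` ({y. f y \<noteq> 0} \<times> {z. g z \<noteq> 0})"
  have fin: "finite ?B" using assms by auto
  have "pairing F (f \<otimes>\<^bsub>A\<^esub> g) = (\<Sum>x\<in>?B. (f \<otimes>\<^bsub>A\<^esub> g) x * F x)"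
    using fin group_algebra_mult_supp by (rule pairing_superset)
  also have "\<dots> = (\<Sum>x\<in>?B. \<Sum>y | f y \<noteq> 0. \<Sum>z | g z \<noteq> 0. f y * g z * of_bool (y \<otimes> z = x) * F x)"
    by (simp add: group_algebra_mult sum_distrib_right)
  also have "\<dots> = (\<Sum>y | f y \<noteq> 0. \<Sum>z | g z \<noteq> 0. \<Sum>x\<in>?B. f y * g z * of_bool (y \<otimes> z = x) * F x)"
    by (simp only: sum.swap[where A = ?B])
  also have "\<dots> = (\<Sum>y | f y \<noteq> 0. \<Sum>z | g z \<noteq> 0. f y * g z * F (y \<otimes> z))"
  proof (intro sum.cong refl)
    fix y z assume yz: "y \<in> {y. f y \<noteq> 0}" "z \<in> {z. g z \<noteq> 0}"
    then have "y \<otimes> z \<in> ?B" by (force simp: image_def)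
    then have "(\<Sum>x\<in>?B. if y \<otimes> z = x then f y * g z * F x else 0) = f y * g z * F (y \<otimes> z)"
      using fin by (subst sum.delta') auto
    then show "(\<Sum>x\<in>?B. f y * g z * of_bool (y \<otimes> z = x) * F x) = f y * g z * F (y \<otimes> z)"
      by (simp add: of_bool_def if_distrib if_distribR cong: if_cong)
  qed
  also have "\<dots> = pairing (\<lambda>y. pairing (\<lambda>z. F (y \<otimes> z)) g) f"
    by (simp add: pairing_def sum_distrib_left mult.assoc)
  finally show ?thesis .
qed

lemma pairing_minus:
  "f \<in> carrier A \<Longrightarrow> g \<in> carrier A \<Longrightarrow> pairing F (\<lambda>x. f x - g x) = pairing F f - pairing F g"
  by (rule pairing_minus_right) auto

lemma pairing_add:
  "f \<in> carrier A \<Longrightarrow> g \<in> carrier A \<Longrightarrow> pairing F (\<lambda>x. f x + g x) = pairing F f + pairing F g"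
  by (rule pairing_add_right) auto

lemma group_algebra_eqI:
  "f \<in> carrier A \<Longrightarrow> g \<in> carrier A \<Longrightarrow> (\<And>F. pairing F f = pairing F g) \<Longrightarrow> f = g"
  by (rule pairing_eqI) auto

text \<open>After pairing with an arbitrary \<open>F\<close>, associativity becomes that of
  \<open>G\<close> inside an iterated pairing; the unit and distributive laws become evaluation and
  additivity.\<close>

lemma ring_group_algebra: "ring A"
proof (rule ringI)
  show "abelian_group A"
  proof (rule abelian_groupI)
    fix f assume f: "f \<in> carrier A"
    have "(\<lambda>x. - 1 * f x) \<oplus>\<^bsub>A\<^esub> f = \<zero>\<^bsub>A\<^esub>" by simp
    moreover have "(\<lambda>x. - 1 * f x) \<in> carrier A" using f by (rule group_algebra_scale_closed)
    ultimately show "\<exists>g\<in>carrier A. g \<oplus>\<^bsub>A\<^esub> f = \<zero>\<^bsub>A\<^esub>" by (rule bexI)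
  qed (simp_all add: add_ac)
  show "Group.monoid A"
  proof
    fix f g h assume fgh: "f \<in> carrier A" "g \<in> carrier A" "h \<in> carrier A"
    show "f \<otimes>\<^bsub>A\<^esub> g \<otimes>\<^bsub>A\<^esub> h = f \<otimes>\<^bsub>A\<^esub> (g \<otimes>\<^bsub>A\<^esub> h)"
      using fgh by (intro group_algebra_eqI)
        (simp_all add: pairing_mult, intro pairing_cong,
            simp add: m_assoc fgh[THEN group_algebra_supp])
  next
    fix f assume f: "f \<in> carrier A"
    show "\<one>\<^bsub>A\<^esub> \<otimes>\<^bsub>A\<^esub> f = f" "f \<otimes>\<^bsub>A\<^esub> \<one>\<^bsub>A\<^esub> = f"
      using f by (auto intro!: group_algebra_eqI[OF _ f] pairing_cong
          simp: pairing_mult group_algebra_supp[OF f])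
  qed auto
  fix f g h assume fgh: "f \<in> carrier A" "g \<in> carrier A" "h \<in> carrier A"
  show "(f \<oplus>\<^bsub>A\<^esub> g) \<otimes>\<^bsub>A\<^esub> h = f \<otimes>\<^bsub>A\<^esub> h \<oplus>\<^bsub>A\<^esub> g \<otimes>\<^bsub>A\<^esub> h"
    using fgh by (intro group_algebra_eqI) (auto simp: pairing_mult pairing_add_right)
  show "h \<otimes>\<^bsub>A\<^esub> (f \<oplus>\<^bsub>A\<^esub> g) = h \<otimes>\<^bsub>A\<^esub> f \<oplus>\<^bsub>A\<^esub> h \<otimes>\<^bsub>A\<^esub> g"
    using fgh by (intro group_algebra_eqI)
      (auto simp: pairing_mult pairing_add_right pairing_add_left)
qed

text \<open>Pairing with the constant 1 is the augmentation, which is multiplicative by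
  \<open>pairing_mult\<close>; one factor of augmentation 0 therefore suffices.\<close>

lemma augmentation_ideal_is_ideal: "ideal (augmentation_ideal G) A"
proof -
  interpret A: ring A by (rule ring_group_algebra)
  have neg: "\<ominus>\<^bsub>A\<^esub> f = (\<lambda>x. - 1 * f x)" if "f \<in> carrier A" for f
    using that group_algebra_scale_closed[OF that, of "- 1"] by (intro A.minus_equality) auto
  show ?thesis
  proof (rule idealI[OF ring_group_algebra])
    show "subgroup (augmentation_ideal G) (add_monoid A)"
    proof (rule A.add.subgroupI)
      fix f assume "f \<in> augmentation_ideal G"
      then show "\<ominus>\<^bsub>A\<^esub> f \<in> augmentation_ideal G"
        using group_algebra_scale_closed[of f "- 1"] pairing_scale_right[of "\<lambda>x. 1" "- 1" f]
        by (simp add: augmentation_ideal_eq neg)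
    next
      show "augmentation_ideal G \<noteq> {}"
        by (auto simp: augmentation_ideal_eq intro!: exI[of _ "\<lambda>x. 0"])
    qed (auto simp: augmentation_ideal_eq pairing_add_right)
  qed (auto simp: augmentation_ideal_eq pairing_mult pairing_const[of "pairing _ _"])
qed
end

section \<open>The cube of the augmentation ideal\<close>

context group
begin

abbreviation "I \<equiv> augmentation_ideal G"

text \<open>Each of the seven terms replacing \<open>F (a \<otimes> b \<otimes> c)\<close> omits at
  least one variable, and a constant pairs to 0 with an element of augmentation 0.\<close>

lemma pairing_mult3_augmentation:
  assumes F: "quadratic F" and u: "u \<in> I" and v: "v \<in> I" and w: "w \<in> I"
  shows "pairing F (u \<otimes>\<^bsub>A\<^esub> v \<otimes>\<^bsub>A\<^esub> w) = 0"
proof -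
  have C: "u \<in> carrier A" "v \<in> carrier A" "w \<in> carrier A"
    and [simp]: "pairing (\<lambda>x. q) u = 0" "pairing (\<lambda>x. q) v = 0" "pairing (\<lambda>x. q) w = 0" for q
    using u v w by (simp_all add: augmentation_ideal_eq pairing_const[of q])
  have "pairing F (u \<otimes>\<^bsub>A\<^esub> v \<otimes>\<^bsub>A\<^esub> w) =
      pairing (\<lambda>a. pairing (\<lambda>b. pairing (\<lambda>c. F (a \<otimes> b \<otimes> c)) w) v) u"
    using C by (simp add: pairing_mult)
  also have "\<dots> = pairing (\<lambda>a. pairing (\<lambda>b. pairing (\<lambda>c. F (a \<otimes> b) + F (a \<otimes> c) + F (b \<otimes> c)
      - F a - F b - F c + F \<one>) w) v) u"
    using F unfolding quadratic_def
    by (intro pairing_cong) (auto dest: group_algebra_supp[OF C(1)] group_algebra_supp[OF C(2)] group_algebra_supp[OF C(3)])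
  also have "\<dots> = 0"
    by (simp add: pairing_add_left pairing_minus_left)
  finally show ?thesis .
qed

text \<open>The exponent is one more than the nilpotency class of the Heisenberg group.\<close>

definition cube :: "('a \<Rightarrow> rat) set" where
  "cube = I [^]\<^bsub>ideals_set A\<^esub> (3 :: nat)"

text \<open>Powers in \<open>ideals_set\<close> start from its unit, the whole ring, whence the
  leading factor \<open>carrier A\<close>.\<close>

lemma cube_eq: "cube = carrier A \<cdot>\<^bsub>A\<^esub> I \<cdot>\<^bsub>A\<^esub> I \<cdot>\<^bsub>A\<^esub> I"
  by (simp add: cube_def nat_pow_def ideals_set_def numeral_3_eq_3)

lemma ideal_cube: "ideal cube A"
proof -
  interpret A: ring A by (rule ring_group_algebra)
  show ?thesis unfolding cube_eq
    using augmentation_ideal_is_ideal A.oneideal by (intro A.ideal_prod_is_ideal)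
qed

lemma mult3_in_cube:
  assumes "u \<in> I" "v \<in> I" "w \<in> I"
  shows "u \<otimes>\<^bsub>A\<^esub> v \<otimes>\<^bsub>A\<^esub> w \<in> cube"
proof -
  interpret A: ring A by (rule ring_group_algebra)
  \<comment> \<open>The unit supplies the leading factor \<open>carrier A\<close> of the
    cube.\<close>
  have "u = \<one>\<^bsub>A\<^esub> \<otimes>\<^bsub>A\<^esub> u" using assms(1) A.l_one by
      (simp add: augmentation_ideal_eq del: group_algebra_simps)
  then have "u \<in> carrier A \<cdot>\<^bsub>A\<^esub> I" using ideal_prod.prod[of "\<one>\<^bsub>A\<^esub>" "carrier A" u I A] assms(1) by auto
  then show ?thesis unfolding cube_eq using assms by (intro ideal_prod.prod)
qed

text \<open>\<open>ideal_prod\<close> is inductive, so products and sums are enough. The product of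
  \<open>carrier A\<close> and \<open>I\<close> lies in \<open>I\<close>, which reduces to three
  factors from \<open>I\<close>; sums inside the left factor are absorbed in \<open>2\<close> by
  distributivity.\<close>

lemma pairing_cube:
  assumes F: "quadratic F" and f: "f \<in> cube"
  shows "pairing F f = 0"
proof -
  interpret A: ring A by (rule ring_group_algebra)
  note id = augmentation_ideal_is_ideal
  note id1 = A.ideal_prod_is_ideal[OF A.oneideal id]
  note id2 = A.ideal_prod_is_ideal[OF id1 id]
  have I: "u \<in> carrier A" if "u \<in> I" for u using that by (simp add: augmentation_ideal_eq)
  have 2: "s \<in> carrier A \<and> pairing F (s \<otimes>\<^bsub>A\<^esub> w) = 0"
    if "s \<in> carrier A \<cdot>\<^bsub>A\<^esub> I \<cdot>\<^bsub>A\<^esub> I" and w: "w \<in> I" for s w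
    using that(1)
  proof (induction s rule: ideal_prod.induct)
    case (prod u v)
    have "u \<in> I" using prod(1) A.ideal_prod_inter[OF A.oneideal id] by auto
    then show ?case using prod(2) w F I by (simp add: pairing_mult3_augmentation)
  next
    case (sum s t)
    have "(s \<oplus>\<^bsub>A\<^esub> t) \<otimes>\<^bsub>A\<^esub> w = s \<otimes>\<^bsub>A\<^esub> w \<oplus>\<^bsub>A\<^esub> t \<otimes>\<^bsub>A\<^esub> w"
      using sum I[OF w] by (intro A.l_distr) auto
    then show ?case using sum I[OF w] by (simp add: pairing_add_right)
  qed
  have "f \<in> carrier A \<and> pairing F f = 0"
    using f unfolding cube_eq
  proof (induction f rule: ideal_prod.induct)
    case (prod s w) then show ?case using 2 I by simp
  next
    case (sum s t) then show ?case by (simp add: pairing_add_right)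
  qed
  then show ?thesis by simp
qed

lemma cube_add: "f \<in> cube \<Longrightarrow> g \<in> cube \<Longrightarrow> (\<lambda>x. f x + g x) \<in> cube"
  using additive_subgroup.a_closed[OF ideal.axioms(1)[OF ideal_cube], of f g] by simp

text \<open>An ideal is closed under ring multiplication, so scaling by \<open>q\<close> is realised
  as multiplication by \<open>q\<close> times the unit.\<close>

lemma cube_scale:
  assumes "f \<in> cube" shows "(\<lambda>x. q * f x) \<in> cube"
proof -
  have f: "f \<in> carrier A" using assms ideal.Icarr[OF ideal_cube] by blast
  have "(\<lambda>x. q * group_elem \<one> x) \<otimes>\<^bsub>A\<^esub> f = (\<lambda>x. q * f x)"
    using f by (intro group_algebra_eqI)
      (auto simp: pairing_mult pairing_scale_right intro!: pairing_cong dest: group_algebra_supp)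
  then show ?thesis
    using ideal.I_l_closed[OF ideal_cube assms, of "\<lambda>x. q * group_elem \<one> x"] by simp
qed

lemma group_elem_minus_one_in_I: "a \<in> carrier G \<Longrightarrow> (\<lambda>x. group_elem a x - group_elem \<one> x) \<in> I"
  by (simp add: augmentation_ideal_eq pairing_minus_right)

text \<open>If \<open>f\<close> lay outside the cube, some linear functional would vanish on the
  cube but not at \<open>f\<close>. Its values on group elements form a quadratic \<open>F\<close>,
  because (a - 1)(b - 1)(c - 1) lies in the cube.\<close>

lemma separating_quadratic:
  assumes f: "f \<in> carrier A" "\<And>F. quadratic F \<Longrightarrow> pairing F f = 0"
  shows "f \<in> cube"
proof (rule ccontr)
  assume "f \<notin> cube"
  have 0: "(\<lambda>x. 0) \<in> cube"
    using additive_subgroup.zero_closed[OF ideal.axioms(1)[OF ideal_cube]] by simp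
  obtain \<phi> where add: "\<And>f g. \<phi> (\<lambda>x. f x + g x) = \<phi> f + \<phi> g"
    and scale: "\<And>q f. \<phi> (\<lambda>x. q * f x) = q * \<phi> f"
    and J: "\<And>f. f \<in> cube \<Longrightarrow> \<phi> f = 0" and 1: "\<phi> f = 1"
    using linear_functional_separates[of cube f] 0 cube_add cube_scale \<open>f \<notin> cube\<close> by blast
  define F where "F = (\<lambda>g. \<phi> (group_elem g))"
  \<comment> \<open>\<open>h\<close> is a finite combination of group elements, so the linear
    \<open>\<phi>\<close> is determined on it by \<open>F\<close>.\<close>
  have pairing: "pairing F h = \<phi> h" if h: "h \<in> carrier A" for h
  proof -
    have "\<phi> (\<lambda>x. \<Sum>y\<in>Y. h y * group_elem y x) = (\<Sum>y\<in>Y. h y * F y)" if "finite Y" for Y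
      using that
    proof (induction Y rule: finite_induct)
      case empty show ?case using scale[of 0] by simp
    qed (simp add: add scale F_def)
    from this[of "{x. h x \<noteq> 0}"] h have "\<phi> (\<lambda>x. \<Sum>y | h y \<noteq> 0. h y * group_elem y x) = pairing F h"
      by (simp add: pairing_def)
    moreover have "(\<lambda>x. \<Sum>y | h y \<noteq> 0. h y * group_elem y x) = h"
    proof
      fix x
      have "(\<Sum>y | h y \<noteq> 0. h y * group_elem y x) = pairing (\<lambda>y. of_bool (y = x)) h"
        unfolding pairing_def group_elem_def by (simp add: eq_commute[of x])
      then show "(\<Sum>y | h y \<noteq> 0. h y * group_elem y x) = h x" using h by (simp add: pairing_eval)
    qed
    ultimately show ?thesis by simp
  qed
  have "quadratic F"
    unfolding quadratic_def
  proof (intro ballI)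
    fix a b c assume abc: "a \<in> carrier G" "b \<in> carrier G" "c \<in> carrier G"
    define D where "D = (\<lambda>g x. group_elem g x - group_elem \<one> x)"
    have D: "D g \<in> I" "D g \<in> carrier A" if "g \<in> carrier G" for g
      using group_elem_minus_one_in_I[OF that] that by (simp_all add: D_def augmentation_ideal_eq)
    have pD: "pairing H (D g) = H g - H \<one>" if "g \<in> carrier G" for H g
      using that by (simp add: D_def pairing_minus_right)
    let ?u = "D a \<otimes>\<^bsub>A\<^esub> D b \<otimes>\<^bsub>A\<^esub> D c"
    have "pairing F ?u = 0"
      using abc D by (subst pairing) (auto intro!: J mult3_in_cube)
    then show "F (a \<otimes> b \<otimes> c) =
        F (a \<otimes> b) + F (a \<otimes> c) + F (b \<otimes> c) - F a - F b - F c + F \<one>"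
      using abc D by (simp add: pairing_mult pD pairing_minus_left)
  qed
  with f 1 pairing[OF f(1)] show False by simp
qed

lemma cube_iff: "f \<in> cube \<longleftrightarrow> f \<in> carrier A \<and> (\<forall>F. quadratic F \<longrightarrow> pairing F f = 0)"
  using separating_quadratic pairing_cube ideal.Icarr[OF ideal_cube] by blast

end

section \<open>The quotient by the cube\<close>

context group
begin

abbreviation "cls f \<equiv> cube +>\<^bsub>A\<^esub> f"

abbreviation "V \<equiv> quotient_algebra A cube"

lemma cls_eq: "cls f = {\<lambda>x. j x + f x | j. j \<in> cube}"
  by (auto simp: a_r_coset_def')

lemma carrier_V: "carrier V = cls ` carrier A"
  by (auto simp: quotient_algebra_def FactRing_def A_RCOSETS_def')

text \<open>Members of a coset differ by elements of the cube, so pairing with a quadratic function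
  descends to the quotient.\<close>

lemma pairing_cls:
  assumes "quadratic F" "f \<in> carrier A" "h \<in> cls f"
  shows "pairing F h = pairing F f"
  using assms pairing_cube[OF assms(1)] ideal.Icarr[OF ideal_cube]
  by (auto simp: cls_eq pairing_add_right)

lemma cls_eqI:
  assumes "f \<in> carrier A" "g \<in> carrier A" "\<And>F. quadratic F \<Longrightarrow> pairing F f = pairing F g"
  shows "cls f = cls g"
proof -
  have *: "cls f \<subseteq> cls g" if fg: "f \<in> carrier A" "g \<in> carrier A"
    "\<And>F. quadratic F \<Longrightarrow> pairing F f = pairing F g" for f g
  proof
    fix h assume "h \<in> cls f"
    then obtain j where j: "j \<in> cube" "h = (\<lambda>x. j x + f x)" by (auto simp: cls_eq)
    have "(\<lambda>x. f x - g x) \<in> cube" using fg by (simp add: cube_iff pairing_minus_right)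
    then have "(\<lambda>x. j x + (f x - g x)) \<in> cube" using j cube_add by blast
    then show "h \<in> cls g" using j by (auto simp: cls_eq intro!: exI[of _ "\<lambda>x. j x + (f x - g x)"])
  qed
  show ?thesis using *[of f g] *[of g f] assms by auto
qed

lemma self_in_cls: "f \<in> cls f"
  using additive_subgroup.zero_closed[OF ideal.axioms(1)[OF ideal_cube]]
  by (auto simp: cls_eq intro!: exI[of _ "\<lambda>x. 0"])

lemma V_simps:
  assumes "f \<in> carrier A"
  shows "g \<in> carrier A \<Longrightarrow> cls f \<oplus>\<^bsub>V\<^esub> cls g = cls (\<lambda>x. f x + g x)"
    and "q \<odot>\<^bsub>V\<^esub> cls f = cls (\<lambda>x. q * f x)"
proof -
  interpret A: ring A by (rule ring_group_algebra)
  interpret J: ideal cube A by (rule ideal_cube)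
  show "cls f \<oplus>\<^bsub>V\<^esub> cls g = cls (\<lambda>x. f x + g x)" if "g \<in> carrier A"
    using J.a_rcos_sum[OF assms that] by (simp add: quotient_algebra_def FactRing_def)
  \<comment> \<open>Scaling in \<open>quotient_algebra\<close> is a union over representatives; all
    the cosets in it coincide.\<close>
  have "cls (\<lambda>x. q * h x) = cls (\<lambda>x. q * f x)" if "h \<in> cls f" for h
    using that assms J.Icarr by (intro cls_eqI) (auto simp: pairing_scale_right pairing_cls cls_eq)
  then have "(\<Union>h\<in>cls f. cls (\<lambda>x. q * h x)) = (\<Union>h\<in>cls f. cls (\<lambda>x. q * f x))"
    by (intro SUP_cong refl)
  also have "\<dots> = cls (\<lambda>x. q * f x)" using self_in_cls[of f] by (intro cSUP_const) blast
  finally show "q \<odot>\<^bsub>V\<^esub> cls f = cls (\<lambda>x. q * f x)" by (simp add: quotient_algebra_def)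
qed

lemma V_zero: "\<zero>\<^bsub>V\<^esub> = cls (\<lambda>x. 0)"
  by (auto simp: quotient_algebra_def FactRing_def cls_eq)

lemma vectorspace_V: "vectorspace QQ V"
proof (rule vs_criteria)
  show "field QQ" by (rule class_field)
  show "\<forall>v\<in>carrier V. \<exists>w\<in>carrier V. v \<oplus>\<^bsub>V\<^esub> w = \<zero>\<^bsub>V\<^esub>"
  proof
    fix v assume "v \<in> carrier V"
    then obtain f where f: "f \<in> carrier A" "v = cls f" by (auto simp: carrier_V)
    have g: "(\<lambda>x. - 1 * f x) \<in> carrier A" using f(1) by (rule group_algebra_scale_closed)
    have "v \<oplus>\<^bsub>V\<^esub> cls (\<lambda>x. - 1 * f x) = \<zero>\<^bsub>V\<^esub>"
      unfolding f(2) V_simps(1)[OF f(1) g] by (simp add: V_zero)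
    moreover have "cls (\<lambda>x. - 1 * f x) \<in> carrier V" unfolding carrier_V using g by (rule imageI)
    ultimately show "\<exists>w\<in>carrier V. v \<oplus>\<^bsub>V\<^esub> w = \<zero>\<^bsub>V\<^esub>" by blast
  qed
qed (auto simp: carrier_V V_simps V_zero algebra_simps distrib_right)

lemma finsum_V:
  assumes "finite S" "\<And>k. k \<in> S \<Longrightarrow> e k \<in> carrier A"
  shows "(\<Oplus>\<^bsub>V\<^esub>k\<in>S. c k \<odot>\<^bsub>V\<^esub> cls (e k)) = cls (\<lambda>x. \<Sum>k\<in>S. c k * e k x)"
proof -
  interpret V: vectorspace QQ V by (rule vectorspace_V)
  show ?thesis using assms
  proof (induction S rule: finite_induct)
    case empty show ?case by (simp add: V_zero)
  next
    case (insert k S)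
    have C: "c l \<odot>\<^bsub>V\<^esub> cls (e l) \<in> carrier V" if "l \<in> insert k S" for l
      using insert.prems[OF that] by (auto simp: V_simps carrier_V)
    have "(\<Oplus>\<^bsub>V\<^esub>l\<in>insert k S. c l \<odot>\<^bsub>V\<^esub> cls (e l)) = c k \<odot>\<^bsub>V\<^esub> cls (e k) \<oplus>\<^bsub>V\<^esub> (\<Oplus>\<^bsub>V\<^esub>l\<in>S. c l \<odot>\<^bsub>V\<^esub> cls (e l))"
      using insert C by (intro V.M.finsum_insert) auto
    also have "\<dots> = cls (\<lambda>x. c k * e k x + (\<Sum>l\<in>S. c l * e l x))"
      using insert by (simp add: V_simps group_algebra_sum_closed)
    finally show ?case using insert by simp
  qed
qed

text \<open>The \<open>p k\<close> descend to functionals dual to the classes of the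
  \<open>e k\<close>. It is enough to have \<open>expand\<close> on group elements: it extends
  linearly, and quadratic functions separate cosets.\<close>

lemma dim_V:
  assumes fin: "finite K" and e: "\<And>k. k \<in> K \<Longrightarrow> e k \<in> carrier A"
    and p: "\<And>k. k \<in> K \<Longrightarrow> quadratic (p k)"
    and dual: "\<And>k l. k \<in> K \<Longrightarrow> l \<in> K \<Longrightarrow> pairing (p k) (e l) = of_bool (k = l)"
    and expand: "\<And>F g. quadratic F \<Longrightarrow> g \<in> carrier G \<Longrightarrow> F g = (\<Sum>k\<in>K. p k g * pairing F (e k))"
  shows "vectorspace.fin_dim QQ V \<and> vectorspace.dim QQ V = card K"
proof -
  interpret V: vectorspace QQ V by (rule vectorspace_V)
  \<comment> \<open>\<open>SOME\<close> picks a representative; by \<open>pairing_cls\<close> the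
    value does not depend on it.\<close>
  define \<phi> where "\<phi> = (\<lambda>k X. pairing (p k) (SOME f. f \<in> X))"
  have \<phi>: "\<phi> k (cls f) = pairing (p k) f" if "k \<in> K" "f \<in> carrier A" for k f
    unfolding \<phi>_def using p[OF that(1)] that(2)
    by (rule pairing_cls) (rule someI[of "\<lambda>h. h \<in> cls f"], rule self_in_cls)
  show ?thesis
  proof (rule V.dim_dual_family[where e = "\<lambda>k. cls (e k)" and \<phi> = \<phi>])
    fix v assume "v \<in> carrier V"
    then obtain f where f: "f \<in> carrier A" "v = cls f" by (auto simp: carrier_V)
    have "(\<Oplus>\<^bsub>V\<^esub>k\<in>K. \<phi> k v \<odot>\<^bsub>V\<^esub> cls (e k)) = cls (\<lambda>x. \<Sum>k\<in>K. \<phi> k v * e k x)"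
      using fin e by (rule finsum_V)
    also have "\<dots> = v"
      unfolding f(2)
    proof (rule cls_eqI)
      show "(\<lambda>x. \<Sum>k\<in>K. \<phi> k (cls f) * e k x) \<in> carrier A"
        using e by (intro group_algebra_sum_closed) auto
      fix F assume F: "quadratic F"
      have "pairing F (\<lambda>x. \<Sum>k\<in>K. \<phi> k (cls f) * e k x) = (\<Sum>k\<in>K. pairing (p k) f * pairing F (e k))"
        using e f by (subst pairing_sum_right)
            (auto simp: \<phi> pairing_scale_right group_algebra_finite[OF group_algebra_scale_closed])
      also have "\<dots> = pairing (\<lambda>x. \<Sum>k\<in>K. pairing F (e k) * p k x) f"
        by (simp add: pairing_sum_left pairing_scale_left) (simp add: mult.commute)
      also have "\<dots> = pairing F f"
        using expand[OF F] group_algebra_supp[OF f(1)]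
            by (intro pairing_cong) (simp add: mult.commute)
      finally show "pairing F (\<lambda>x. \<Sum>k\<in>K. \<phi> k (cls f) * e k x) = pairing F f" .
    qed (rule f)
    finally show "(\<Oplus>\<^bsub>V\<^esub>k\<in>K. \<phi> k v \<odot>\<^bsub>V\<^esub> cls (e k)) = v" .
  qed (use fin e dual in \<open>auto simp: carrier_V \<phi> V_simps pairing_add_right pairing_scale_right of_bool_def\<close>)
qed

end

section \<open>Groups with Heisenberg coordinates\<close>

lemma (in group) additive_one:
  fixes \<phi> :: "'a \<Rightarrow> 'r::ring_1"
  assumes "\<And>g h. g \<in> carrier G \<Longrightarrow> h \<in> carrier G \<Longrightarrow> \<phi> (g \<otimes> h) = \<phi> g + \<phi> h"
  shows "\<phi> \<one> = 0"
  using assms[of \<one> \<one>] by simp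

lemma (in group) additive_inv:
  fixes \<phi> :: "'a \<Rightarrow> 'r::ring_1"
  assumes "\<And>g h. g \<in> carrier G \<Longrightarrow> h \<in> carrier G \<Longrightarrow> \<phi> (g \<otimes> h) = \<phi> g + \<phi> h"
    and "g \<in> carrier G"
  shows "\<phi> (inv g) = - \<phi> g"
  using assms(1)[of "inv g" g] additive_one[of \<phi>] assms by (simp add: eq_neg_iff_add_eq_0)

lemma (in group) additive_int_pow:
  fixes \<phi> :: "'a \<Rightarrow> 'r::ring_1"
  assumes "\<And>g h. g \<in> carrier G \<Longrightarrow> h \<in> carrier G \<Longrightarrow> \<phi> (g \<otimes> h) = \<phi> g + \<phi> h"
    and g: "g \<in> carrier G"
  shows "\<phi> (g [^] (z :: int)) = of_int z * \<phi> g"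
proof -
  have step: "\<phi> (g [^] (z + 1)) = \<phi> (g [^] z) + \<phi> g" for z :: int
    using g assms(1) by (simp add: int_pow_mult)
  show ?thesis
  proof (induction z rule: int_induct[where k = 0])
    case base then show ?case using additive_one[of \<phi>] assms by simp
  next
    case (step1 i) then show ?case using step[of i] by (simp add: algebra_simps)
  next
    case (step2 i) then show ?case using step[of "i - 1"] by (simp add: algebra_simps)
  qed
qed

section \<open>Polarization of quadratic functions\<close>

context group
begin

text \<open>The value of the linear extension of \<open>F\<close> at (g - 1)(h - 1).\<close>

definition polar :: "('a \<Rightarrow> rat) \<Rightarrow> 'a \<Rightarrow> 'a \<Rightarrow> rat" where
  "polar F g h = F (g \<otimes> h) - F g - F h + F \<one>"

text \<open>Both additivity laws are the defining identity of \<open>quadratic\<close>, with the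
  triple product grouped as (ab)c or as a(bc).\<close>

lemma polar_mult_left:
  assumes "quadratic F" "a \<in> carrier G" "b \<in> carrier G" "c \<in> carrier G"
  shows "polar F (a \<otimes> b) c = polar F a c + polar F b c"
  using assms unfolding quadratic_def polar_def by simp

lemma polar_mult_right:
  assumes "quadratic F" "a \<in> carrier G" "b \<in> carrier G" "c \<in> carrier G"
  shows "polar F a (b \<otimes> c) = polar F a b + polar F a c"
  using assms unfolding quadratic_def polar_def by (simp add: m_assoc[symmetric])

text \<open>The increment from z to z + 1 is F(g) - F(1) plus z times the diagonal polarization, and
  summing z gives the binomial coefficient. Induction in both directions covers negative
  exponents.\<close>

lemma quadratic_int_pow:
  assumes F: "quadratic F" and g: "g \<in> carrier G"
  shows "F (g [^] (z :: int)) =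
    F \<one> + of_int z * (F g - F \<one>) + of_int z * (of_int z - 1) / 2 * polar F g g"
proof -
  have "F (g [^] (z + 1)) = F (g [^] z) + F g - F \<one> + polar F (g [^] z) g" for z :: int
    using g by (simp add: int_pow_mult polar_def)
  moreover have "polar F (g [^] z) g = of_int z * polar F g g" for z :: int
    using g polar_mult_left[OF F] by (intro additive_int_pow) auto
  ultimately have step: "F (g [^] (z + 1)) = F (g [^] z) + F g - F \<one> + of_int z * polar F g g"
      for z :: int
    by simp
  show ?thesis
  proof (induction z rule: int_induct[where k = 0])
    case (step1 i) then show ?case using step[of i] by (simp add: field_simps)
  next
    case (step2 i) then show ?case using step[of "i - 1"] by (simp add: field_simps)
  qed simp
qed

end

text \<open>Indices start at 0: \<open>a i\<close> and \<open>a (m + i)\<close> for i < m are the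
  noncommuting pairs, and \<open>a (2 * m)\<close> is central. Sorting a product moves the powers of
  \<open>a i\<close> from \<open>h\<close> to the left past those of \<open>a (m + i)\<close> from
  \<open>g\<close>; this costs the subtracted sum in \<open>x_last_mult\<close>.\<close>

locale heisenberg_coordinates = group +
  fixes m :: nat and a :: "nat \<Rightarrow> 'a" and x :: "nat \<Rightarrow> 'a \<Rightarrow> int"
  assumes m: "m \<ge> 1"
    and a_closed: "i \<le> 2 * m \<Longrightarrow> a i \<in> carrier G"
    and x_mult: "i < 2 * m \<Longrightarrow> g \<in> carrier G \<Longrightarrow> h \<in> carrier G \<Longrightarrow> x i (g \<otimes> h) = x i g + x i h"
    and x_last_mult: "g \<in> carrier G \<Longrightarrow> h \<in> carrier G \<Longrightarrow>
      x (2 * m) (g \<otimes> h) = x (2 * m) g + x (2 * m) h - (\<Sum>i<m. x (m + i) g * x i h)"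
    and x_a: "i \<le> 2 * m \<Longrightarrow> j \<le> 2 * m \<Longrightarrow> x i (a j) = of_bool (i = j)"
    and x_inj: "g \<in> carrier G \<Longrightarrow> h \<in> carrier G \<Longrightarrow> (\<And>i. i \<le> 2 * m \<Longrightarrow> x i g = x i h) \<Longrightarrow> g = h"
begin

lemma x_one: "i \<le> 2 * m \<Longrightarrow> x i \<one> = 0"
proof -
  have "x i \<one> = 0" if "i < 2 * m" for i
    using x_mult[OF that, of \<one> \<one>] by simp
  moreover from this have "x (2 * m) \<one> = 0"
    using x_last_mult[of \<one> \<one>] by simp
  ultimately show "i \<le> 2 * m \<Longrightarrow> x i \<one> = 0" by (cases "i = 2 * m") auto
qed

lemma x_int_pow:
  assumes "i < 2 * m" "g \<in> carrier G" shows "x i (g [^] (z :: int)) = z * x i g"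
  using additive_int_pow[of "x i" g z] x_mult[OF assms(1)] assms(2) by simp

text \<open>Final segments of the Mal'cev product, made for induction from its right end.\<close>

definition tail :: "(nat \<Rightarrow> int) \<Rightarrow> nat \<Rightarrow> 'a" where
  "tail c k = malcev_prod G (map a [k..<2 * m + 1]) (map c [k..<2 * m + 1])"

lemma tail_last: "tail c (Suc (2 * m)) = \<one>"
  by (simp add: tail_def malcev_prod_def)

lemma tail_rec: "k \<le> 2 * m \<Longrightarrow> tail c k = a k [^] c k \<otimes> tail c (Suc k)"
  by (simp add: tail_def malcev_prod_def upt_conv_Cons del: upt_Suc)

lemma tail_induct [consumes 1, case_names last step]:
  assumes "k \<le> 2 * m + 1" "P (2 * m + 1)" "\<And>k. k \<le> 2 * m \<Longrightarrow> P (Suc k) \<Longrightarrow> P k"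
  shows "P k"
  using assms(1,2,3) by (rule inc_induct) auto

lemma tail_closed: "k \<le> 2 * m + 1 \<Longrightarrow> tail c k \<in> carrier G"
  by (induction k rule: tail_induct) (auto simp: tail_last tail_rec[of _ c] a_closed)

text \<open>The last coordinate is not a homomorphism, but its polarization is minus a sum of
  products of homomorphisms, one in each argument, hence bilinear.\<close>

lemma quadratic_x:
  assumes "i \<le> 2 * m" shows "quadratic (\<lambda>g. of_int (x i g))"
proof (cases "i = 2 * m")
  case True
  then show ?thesis unfolding quadratic_def
    by (simp add: x_last_mult x_mult x_one) (simp add: sum.distrib algebra_simps)
next
  case False
  with assms show ?thesis unfolding quadratic_def by (simp add: x_mult x_one)
qed

text \<open>The order \<open>j \<le> k\<close> matters: a correction term requires j = m + i and k =
  i, as in \<open>a m \<otimes> a 0\<close>, whose last coordinate is -1.\<close>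

lemma x_mult_a:
  assumes "i \<le> 2 * m" "j \<le> k" "k < 2 * m"
  shows "x i (a j \<otimes> a k) = of_bool (i = j) + of_bool (i = k)"
proof (cases "i = 2 * m")
  case True
  have "(\<Sum>i<m. x (m + i) (a j) * x i (a k)) = 0"
    using assms by (intro sum.neutral) (auto simp: x_a)
  then show ?thesis using assms True by (simp add: x_last_mult a_closed x_a)
next
  case False
  with assms show ?thesis by (simp add: x_mult a_closed x_a)
qed

text \<open>Additivity fails for the last coordinate, so the power formula for quadratic functions
  takes its place; the diagonal polarization is 0 because no generator has nonzero coordinates at
  both i and m + i.\<close>

lemma x_last_pow_a:
  assumes "k \<le> 2 * m" shows "x (2 * m) (a k [^] (z :: int)) = z * of_bool (k = 2 * m)"
proof -
  have "(\<Sum>i<m. x (m + i) (a k) * x i (a k)) = 0"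
    using assms by (intro sum.neutral) (auto simp: x_a)
  then have "polar (\<lambda>g. of_int (x (2 * m) g)) (a k) (a k) = 0"
    using assms by (simp add: polar_def x_last_mult a_closed x_one)
  then have "of_int (x (2 * m) (a k [^] z)) = (of_int (z * of_bool (k = 2 * m)) :: rat)"
    using quadratic_int_pow[OF quadratic_x[of "2 * m"] a_closed[OF assms], of z] assms
    by (simp add: x_one x_a)
  then show ?thesis using of_int_eq_iff by blast
qed

text \<open>A product of powers in increasing order is already sorted, so its exponents are its
  coordinates.\<close>

lemma x_tail:
  assumes "k \<le> 2 * m + 1" "i \<le> 2 * m"
  shows "x i (tail c k) = (if k \<le> i then c i else 0)"
  using assms
proof (induction k arbitrary: i rule: tail_induct)
  case last then show ?case by (simp add: tail_last x_one)
next
  case (step k)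
  note C = a_closed[OF step(1)] tail_closed[of "Suc k" c]
  note rec = tail_rec[OF step(1), of c]
  show ?case
  proof (cases "i = 2 * m")
    case True
    \<comment> \<open>A power of \<open>a k\<close> has a nonzero coordinate m + j only if k = m +
      j, and then coordinate j of the tail beyond k is 0 because j < k.\<close>
    have "(\<Sum>j<m. x (m + j) (a k [^] c k) * x j (tail c (Suc k))) = 0"
      using step C by (intro sum.neutral) (auto simp: x_int_pow x_a)
    then show ?thesis unfolding rec using True step C
      by (cases "k = 2 * m") (auto simp: x_last_mult x_last_pow_a)
  next
    case False
    then show ?thesis unfolding rec using step C
      by (cases "k = i") (auto simp: x_mult x_int_pow x_a)
  qed
qed

lemma tail_coordinates: "g \<in> carrier G \<Longrightarrow> tail (\<lambda>i. x i g) 0 = g"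
  by (rule x_inj) (auto simp: tail_closed x_tail)

abbreviation "bs \<equiv> map a [0..<2 * m + 1]"

text \<open>Existence of the exponents is \<open>tail_coordinates\<close>; uniqueness holds since
  \<open>x_tail\<close> recovers every exponent from the product.\<close>

lemma malcev_coords:
  assumes g: "g \<in> carrier G"
  shows "malcev_coords G bs g = map (\<lambda>i. x i g) [0..<2 * m + 1]"
  unfolding malcev_coords_def
proof (rule the_equality)
  show "length (map (\<lambda>i. x i g) [0..<2 * m + 1]) = length bs \<and>
      malcev_prod G bs (map (\<lambda>i. x i g) [0..<2 * m + 1]) = g"
    using tail_coordinates[OF g] by (simp add: tail_def)
  fix xs assume xs: "length xs = length bs \<and> malcev_prod G bs xs = g"
  then have eq: "xs = map (\<lambda>i. xs ! i) [0..<2 * m + 1]"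
      by (intro nth_equalityI) (auto simp del: upt_Suc)
  with xs have "tail (\<lambda>i. xs ! i) 0 = g" unfolding tail_def by metis
  then have "x i g = xs ! i" if "i \<le> 2 * m" for i
    using x_tail[of 0 i "\<lambda>i. xs ! i"] that by simp
  then show "xs = map (\<lambda>i. x i g) [0..<2 * m + 1]" by (subst eq) (auto simp del: upt_Suc)
qed

lemma coord_fun:
  "i \<le> 2 * m \<Longrightarrow> coord_fun G bs i = (\<lambda>h\<in>carrier G. of_int (x i h))"
  unfolding coord_fun_def
  by (rule restrict_ext, subst malcev_coords, assumption, simp del: upt_Suc)

text \<open>This exhibits the last generator as a commutator, both for \<open>polar_last\<close> and
  for the nilpotency class.\<close>

lemma a_commute: "a 0 \<otimes> a m = a m \<otimes> a 0 \<otimes> a (2 * m)"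
proof (rule x_inj)
  fix i assume i: "i \<le> 2 * m"
  show "x i (a 0 \<otimes> a m) = x i (a m \<otimes> a 0 \<otimes> a (2 * m))"
  proof (cases "i = 2 * m")
    case True
    have "(\<Sum>i<m. x (m + i) (a 0) * x i (a m)) = 0"
      using m by (intro sum.neutral) (auto simp: x_a)
    \<comment> \<open>Only the summand i = 0 survives; it is present because \<open>m\<close> is
      positive.\<close>
    moreover have "(\<Sum>i<m. x (m + i) (a m) * x i (a 0)) = (\<Sum>i<m. of_bool (i = 0))"
      using m by (intro sum.cong) (auto simp: x_a)
    moreover have "(\<Sum>i<m. of_bool (i = 0)) = (1 :: int)"
      using m by (simp add: of_bool_def)
    moreover have "(\<Sum>i<m. x (m + i) (a m \<otimes> a 0) * x i (a (2 * m))) = 0"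
      using m by (intro sum.neutral) (auto simp: x_a)
    ultimately show ?thesis using True m by (simp add: x_last_mult a_closed x_a)
  next
    case False
    then show ?thesis using i by (simp add: x_mult a_closed x_a)
  qed
qed (simp_all add: a_closed)

text \<open>\<open>polar F g\<close> is additive, hence agrees on \<open>a 0 \<otimes> a m\<close>
  and \<open>a m \<otimes> a 0\<close>; by \<open>a_commute\<close> the difference of these values
  is the one at \<open>a (2 * m)\<close>.\<close>

lemma polar_last:
  assumes F: "quadratic F" and g: "g \<in> carrier G"
  shows "polar F g (a (2 * m)) = 0"
proof -
  note C = g a_closed[of 0] a_closed[of m] a_closed[of "2 * m"]
  have "polar F g (a 0 \<otimes> a m) = polar F g (a m \<otimes> a 0 \<otimes> a (2 * m))" by (simp add: a_commute)
  then show ?thesis using C by (simp add: polar_mult_right[OF F])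
qed

lemma polar_tail:
  assumes F: "quadratic F" and g: "g \<in> carrier G" and k: "k \<le> 2 * m + 1"
  shows "polar F g (tail c k) = (\<Sum>j\<in>{k..2 * m}. of_int (c j) * polar F g (a j))"
  using k
proof (induction k rule: tail_induct)
  case last then show ?case using g by (simp add: tail_last polar_def)
next
  case (step k)
  have "polar F g (a k [^] c k) = of_int (c k) * polar F g (a k)"
    using g a_closed[OF step(1)] polar_mult_right[OF F g] by (intro additive_int_pow) auto
  then show ?case
    using step g a_closed[OF step(1)] tail_closed[of "Suc k" c]
    by (simp add: tail_rec polar_mult_right[OF F] sum.atLeast_Suc_atMost)
qed

text \<open>Splitting off the leading power contributes its own value, by
  \<open>quadratic_int_pow\<close>, and its polarization with the rest, which is bilinear in the
  exponents.\<close>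

lemma quadratic_tail:
  assumes F: "quadratic F" and k: "k \<le> 2 * m + 1"
  shows "F (tail c k) = F \<one> + (\<Sum>i\<in>{k..2 * m}. of_int (c i) * (F (a i) - F \<one>)
      + of_int (c i) * (of_int (c i) - 1) / 2 * polar F (a i) (a i)
      + (\<Sum>j\<in>{i<..2 * m}. of_int (c i) * of_int (c j) * polar F (a i) (a j)))"
  using k
proof (induction k rule: tail_induct)
  case last then show ?case by (simp add: tail_last)
next
  case (step k)
  note C = a_closed[OF step(1)] tail_closed[of "Suc k" c]
  have "polar F (a k [^] c k) (tail c (Suc k)) = of_int (c k) * polar F (a k) (tail c (Suc k))"
    using step(1) C polar_mult_left[OF F] by (intro additive_int_pow) auto
  also have "\<dots> = (\<Sum>j\<in>{k<..2 * m}. of_int (c k) * of_int (c j) * polar F (a k) (a j))"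
    using step(1) by (simp add: polar_tail[OF F C(1)] sum_distrib_left mult.assoc atLeastSucAtMost_greaterThanAtMost)
  finally have "F (tail c k) = F (a k [^] c k) + F (tail c (Suc k)) - F \<one> +
      (\<Sum>j\<in>{k<..2 * m}. of_int (c k) * of_int (c j) * polar F (a k) (a j))"
    using step(1) by (simp add: tail_rec polar_def)
  then show ?case
    using step by (simp add: quadratic_int_pow[OF F C(1)] sum.atLeast_Suc_atMost)
qed

end

section \<open>A basis of the quadratic functions and its dual family\<close>

datatype index = Const | Lin nat | Quad nat nat

text \<open>The quadratic part stops before \<open>2 * m\<close>, since polarizations with the last
  generator vanish, while the linear part includes it.\<close>

definition indices :: "nat \<Rightarrow> index set" where
  "indices m = {Const} \<union> Lin ` {..2 * m} \<union> (\<lambda>(i, j). Quad i j) ` (SIGMA i:{..<2 * m}. {i..<2 * m})"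

lemma finite_indices [simp]: "finite (indices m)"
  by (simp add: indices_def)

lemma sum_indices:
  "(\<Sum>k\<in>indices m. f k) = f Const + (\<Sum>i\<in>{..2 * m}. f (Lin i))
      + (\<Sum>i<2 * m. \<Sum>j\<in>{i..<2 * m}. f (Quad i j))"
proof -
  have "(\<Sum>k\<in>indices m. f k) = f Const + ((\<Sum>k\<in>Lin ` {..2 * m}. f k)
      + (\<Sum>k\<in>(\<lambda>(i, j). Quad i j) ` (SIGMA i:{..<2 * m}. {i..<2 * m}). f k))"
    unfolding indices_def Un_assoc by (subst sum.union_disjoint; (subst sum.union_disjoint)?) auto
  also have "(\<Sum>k\<in>Lin ` {..2 * m}. f k) = (\<Sum>i\<in>{..2 * m}. f (Lin i))"
    by (subst sum.reindex) (auto simp: inj_on_def)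
  also have "(\<Sum>k\<in>(\<lambda>(i, j). Quad i j) ` (SIGMA i:{..<2 * m}. {i..<2 * m}). f k)
      = (\<Sum>i<2 * m. \<Sum>j\<in>{i..<2 * m}. f (Quad i j))"
    by (subst sum.reindex) (auto simp: inj_on_def sum.Sigma case_prod_unfold)
  finally show ?thesis by (simp add: add.assoc)
qed

lemma card_indices: "card (indices m) = 2 * m\<^sup>2 + 3 * m + 2"
proof -
  have "card (indices m) = (\<Sum>k\<in>indices m. 1)" by simp
  also have "\<dots> = 1 + (2 * m + 1) + (\<Sum>i<2 * m. 2 * m - i)"
    by (subst sum_indices) simp
  \<comment> \<open>The quadratic indices contribute a triangular number.\<close>
  also have "(\<Sum>i<2 * m. 2 * m - i) = (\<Sum>i\<in>{0..2 * m}. i)"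
  proof -
    have "(\<Sum>i<n. n - i) = (\<Sum>i\<in>{0..n}. i)" for n :: nat
      by (induction n) (simp_all add: Suc_diff_le sum_Suc)
    then show ?thesis .
  qed
  also have "\<dots> = m * (2 * m + 1)"
    using gauss_sum_nat[of "2 * m"] by (simp add: algebra_simps)
  finally show ?thesis by (simp add: power2_eq_square algebra_simps)
qed

context heisenberg_coordinates
begin

text \<open>Unlike the square, the binomial coefficient on the diagonal vanishes at
  \<open>a i\<close>, so it is orthogonal to \<open>dual_elem (Lin i)\<close>.\<close>

fun basis_fun :: "index \<Rightarrow> 'a \<Rightarrow> rat" where
  "basis_fun Const g = 1"
| "basis_fun (Lin i) g = of_int (x i g)"
| "basis_fun (Quad i j) g = (if i = j then of_int (x i g) * (of_int (x i g) - 1) / 2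
     else of_int (x i g) * of_int (x j g))"

text \<open>The last case is (a_i - 1)(a_j - 1) multiplied out. Pairing \<open>F\<close> with these
  elements gives the coefficients that occur in \<open>quadratic_tail\<close>.\<close>

fun dual_elem :: "index \<Rightarrow> 'a \<Rightarrow> rat" where
  "dual_elem Const = group_elem \<one>"
| "dual_elem (Lin i) = (\<lambda>y. group_elem (a i) y - group_elem \<one> y)"
| "dual_elem (Quad i j) = (\<lambda>y. group_elem (a i \<otimes> a j) y - group_elem (a i) y - group_elem (a j) y
    + group_elem \<one> y)"

lemma dual_elem_closed: "k \<in> indices m \<Longrightarrow> dual_elem k \<in> carrier A"
  by (auto simp: indices_def a_closed)

lemma pairing_dual_elem:
  "pairing F (dual_elem Const) = F \<one>"
  "i \<le> 2 * m \<Longrightarrow> pairing F (dual_elem (Lin i)) = F (a i) - F \<one>"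
  "i \<le> 2 * m \<Longrightarrow> j \<le> 2 * m \<Longrightarrow> pairing F (dual_elem (Quad i j)) = polar F (a i) (a j)"
  by (simp_all add: pairing_minus pairing_add polar_def a_closed)

text \<open>A product of two homomorphisms has a bilinear polarization; so has the binomial
  coefficient, for which it is \<open>x i g * x i h\<close>.\<close>

lemma quadratic_basis_fun:
  assumes "k \<in> indices m"
  shows "quadratic (basis_fun k)"
proof (cases k)
  case (Lin i)
  moreover have "basis_fun (Lin i) = (\<lambda>g. of_int (x i g))" by (simp add: fun_eq_iff)
  ultimately show ?thesis using quadratic_x[of i] assms by (auto simp: indices_def)
next
  case (Quad i j)
  with assms show ?thesis
    by (auto simp: indices_def quadratic_def x_mult x_one field_simps)
qed (simp add: quadratic_def)

lemma basis_fun_dual: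
  assumes "k \<in> indices m" "l \<in> indices m" shows "pairing (basis_fun k) (dual_elem l) = of_bool (k
      = l)"
proof (cases l)
  case Const
  with assms show ?thesis
    by (auto simp: indices_def pairing_dual_elem x_one simp del: dual_elem.simps)
next
  case (Lin j)
  with assms show ?thesis
    by (auto simp: indices_def pairing_dual_elem x_one x_a simp del: dual_elem.simps)
next
  case (Quad i j)
  with assms have ij: "i \<le> j" "j < 2 * m" "i \<le> 2 * m" "j \<le> 2 * m" by (auto simp: indices_def)
  \<comment> \<open>Every pairing with \<open>dual_elem (Quad i j)\<close> reduces to values at
    these four group elements; \<open>i \<le> j\<close> keeps the last coordinate of the product
    free of a correction.\<close>
  have coords: "x r \<one> = 0" "x r (a i) = of_bool (r = i)" "x r (a j) = of_bool (r = j)"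
    "x r (a i \<otimes> a j) = of_bool (r = i) + of_bool (r = j)" if "r \<le> 2 * m" for r
    using that ij by (simp_all add: x_one x_a x_mult_a)
  show ?thesis
  proof (cases k)
    case (Quad r s)
    with assms have rs: "r \<le> s" "s < 2 * m" "r \<le> 2 * m" "s \<le> 2 * m" by (auto simp: indices_def)
    show ?thesis using ij rs unfolding \<open>l = _\<close> \<open>k = _\<close> pairing_dual_elem(3)[OF ij(3,4)]
      by (auto simp: polar_def coords)
  qed (use assms ij \<open>l = _\<close> in \<open>auto simp: indices_def pairing_dual_elem polar_def coords
      simp del: dual_elem.simps\<close>)
qed

lemma quadratic_expand:
  assumes F: "quadratic F" and g: "g \<in> carrier G"
  shows "F g = (\<Sum>k\<in>indices m. basis_fun k g * pairing F (dual_elem k))"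
proof -
  define q where "q = (\<lambda>i j. basis_fun (Quad i j) g * polar F (a i) (a j))"
  have last: "polar F (a i) (a (2 * m)) = 0" if "i \<le> 2 * m" for i
    using polar_last[OF F] a_closed[OF that] .
  have "F g = F (tail (\<lambda>i. x i g) 0)" using g by (simp add: tail_coordinates)
  also have "\<dots> = F \<one> + (\<Sum>i\<in>{..2 * m}. basis_fun (Lin i) g * (F (a i) - F \<one>) + (q i i
      + (\<Sum>j\<in>{i<..2 * m}. q i j)))"
    by (subst quadratic_tail[OF F]) (auto simp: q_def atLeast0AtMost add.assoc intro!: sum.cong)
  also have "(\<Sum>i\<in>{..2 * m}. basis_fun (Lin i) g * (F (a i) - F \<one>) + (q i i
      + (\<Sum>j\<in>{i<..2 * m}. q i j)))
     = (\<Sum>i\<in>{..2 * m}. basis_fun (Lin i) g * (F (a i) - F \<one>)) + (\<Sum>i\<in>{..2 * m}. \<Sum>j\<in>{i..2 * m}. q i j)"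
    by (simp add: sum.distrib sum.head)
  \<comment> \<open>The row of the last generator consists of its diagonal term alone, which is 0 by
    \<open>polar_last\<close>; the next step removes its column.\<close>
  also have "(\<Sum>i\<in>{..2 * m}. \<Sum>j\<in>{i..2 * m}. q i j) = (\<Sum>i<2 * m. \<Sum>j\<in>{i..2 * m}. q i j)"
    by (simp add: q_def last flip: lessThan_Suc_atMost)
  also have "\<dots> = (\<Sum>i<2 * m. \<Sum>j\<in>{i..<2 * m}. q i j)"
  proof (rule sum.cong[OF refl])
    fix i assume "i \<in> {..<2 * m}"
    then have "{i..2 * m} = insert (2 * m) {i..<2 * m}" "i \<le> 2 * m" by auto
    then show "(\<Sum>j\<in>{i..2 * m}. q i j) = (\<Sum>j\<in>{i..<2 * m}. q i j)" by (simp add: q_def last)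
  qed
  also have "(\<Sum>i\<le>2 * m. basis_fun (Lin i) g * (F (a i) - F \<one>))
      = (\<Sum>i\<le>2 * m. basis_fun (Lin i) g * pairing F (dual_elem (Lin i)))"
    by (rule sum.cong[OF refl]) (simp add: pairing_dual_elem del: dual_elem.simps)
  also have "(\<Sum>i<2 * m. \<Sum>j\<in>{i..<2 * m}. q i j)
      = (\<Sum>i<2 * m. \<Sum>j\<in>{i..<2 * m}. basis_fun (Quad i j) g * pairing F (dual_elem (Quad i j)))"
    unfolding q_def by (rule sum.cong[OF refl], rule sum.cong[OF refl])
        (simp add: pairing_dual_elem del: dual_elem.simps)
  finally show ?thesis
    by (simp add: sum_indices pairing_dual_elem(1) add.assoc del: dual_elem.simps basis_fun.simps(2,3))
qed

lemma dim_quotient: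
  "vectorspace.fin_dim QQ V \<and> vectorspace.dim QQ V = 2 * m\<^sup>2 + 3 * m + 2"
  using dim_V[OF finite_indices dual_elem_closed quadratic_basis_fun basis_fun_dual quadratic_expand] by (simp add: card_indices)

section \<open>The nilpotency class\<close>

lemma central:
  assumes "g \<in> carrier G" "h \<in> carrier G" "\<And>i. i < 2 * m \<Longrightarrow> x i g = 0"
  shows "g \<otimes> h = h \<otimes> g"
proof (rule x_inj)
  fix i assume "i \<le> 2 * m"
  then show "x i (g \<otimes> h) = x i (h \<otimes> g)"
    using assms by (cases "i = 2 * m") (simp_all add: x_last_mult x_mult)
qed (use assms in auto)

text \<open>With numbering from 0 this is the commutator subgroup; the first \<open>2 * m\<close>
  coordinates are homomorphisms to the integers and kill commutators.\<close>

lemma lower_central_1: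
  assumes "g \<in> lower_central G 1"
  shows "g \<in> carrier G \<and> (\<forall>i<2 * m. x i g = 0)"
proof -
  have inv: "x i (inv g) = - x i g" if "i < 2 * m" "g \<in> carrier G" for i g
    using additive_inv[of "x i" g] x_mult that by simp
  have "g \<in> generate G (\<Union>g \<in> carrier G. \<Union>h \<in> carrier G. {g \<otimes> h \<otimes> inv g \<otimes> inv h})"
    using assms by simp
  then show ?thesis
    by (induction g rule: generate.induct) (auto simp: x_one x_mult inv)
qed

text \<open>Commutators are central by \<open>central\<close>, so the class is at most 2. Class 0 or
  1 would make \<open>a (2 * m)\<close> trivial, the latter through \<open>a_commute\<close>,
  although its last coordinate is 1.\<close>

lemma nilpotency_class: "nilpotency_class G = 2"
  unfolding nilpotency_class_def
proof (rule Least_equality)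
  have comm: "g \<otimes> h \<otimes> inv g \<otimes> inv h = \<one>" if "g \<in> lower_central G 1" "h \<in> carrier G" for g h
  proof -
    have g: "g \<in> carrier G" "g \<otimes> h = h \<otimes> g"
      using lower_central_1[OF that(1)] central[of g h] that(2) by auto
    then show ?thesis using that(2) by (simp add: m_assoc)
  qed
  have one: "\<one> \<in> lower_central G 1" by (auto intro: generate.one)
  have "lower_central G 2 = generate G (\<Union>g \<in> lower_central G 1. \<Union>h
      \<in> carrier G. {g \<otimes> h \<otimes> inv g \<otimes> inv h})"
    by (simp add: numeral_2_eq_2)
  also have "(\<Union>g \<in> lower_central G 1. \<Union>h \<in> carrier G. {g \<otimes> h \<otimes> inv g \<otimes> inv h}) = {\<one>}"
    using comm one by auto
  also have "generate G {\<one>} = {\<one>}" by (rule generate_one)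
  finally show "lower_central G 2 = {\<one>}" .
  fix c assume c: "lower_central G c = {\<one>}"
  show "2 \<le> c"
  proof (rule ccontr)
    assume "\<not> 2 \<le> c"
    then consider "c = 0" | "c = 1" by linarith
    then show False
    proof cases
      case 1
      then have "a (2 * m) = \<one>" using c a_closed[of "2 * m"] by auto
      then show False using x_one[of "2 * m"] x_a[of "2 * m" "2 * m"] by simp
    next
      case 2
      note C = a_closed[of 0] a_closed[of m] a_closed[of "2 * m"]
      have "a 0 \<otimes> a m \<otimes> inv (a 0) \<otimes> inv (a m) \<in> lower_central G 1"
        using C by (auto intro!: generate.incl)
      then have "a 0 \<otimes> a m \<otimes> inv (a 0) \<otimes> inv (a m) = \<one>" using c 2 by simp
      then have "inv (inv (a m)) = a 0 \<otimes> a m \<otimes> inv (a 0)"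
        using C by (intro inv_equality) auto
      then have "a m \<otimes> a 0 = a 0 \<otimes> a m \<otimes> inv (a 0) \<otimes> a 0" using C by simp
      also have "\<dots> = a 0 \<otimes> a m" using C by (simp add: m_assoc)
      finally have "a 0 \<otimes> a m = a m \<otimes> a 0" ..
      then have "a m \<otimes> a 0 \<otimes> a (2 * m) = a m \<otimes> a 0" using a_commute by simp
      then have "a (2 * m) = \<one>" using C by (simp add: l_cancel_one)
      then show False using x_one[of "2 * m"] x_a[of "2 * m" "2 * m"] by simp
    qed
  qed
qed

end

section \<open>Nickel's module\<close>

lemma dual_module_simps [simp]:
  "carrier (dual_module G) = extensional (carrier G)"
  "f \<oplus>\<^bsub>dual_module G\<^esub> g = (\<lambda>h\<in>carrier G. f h + g h)"
  "\<zero>\<^bsub>dual_module G\<^esub> = (\<lambda>h\<in>carrier G. 0)"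
  "q \<odot>\<^bsub>dual_module G\<^esub> f = (\<lambda>h\<in>carrier G. q * f h)"
  by (auto simp: dual_module_def class_ring.func_space_def PiE_def)

lemma vectorspace_dual_module: "vectorspace QQ (dual_module G)"
  unfolding dual_module_def
  by (intro vectorspace.intro class_field class_cring.func_space_is_module)

context heisenberg_coordinates
begin

definition affine :: "('a \<Rightarrow> rat) set" where
  "affine = {f \<in> extensional (carrier G). \<exists>\<alpha> \<beta>. \<forall>h\<in>carrier G. f h
      = \<alpha> + (\<Sum>i\<in>{..2 * m}. \<beta> i * of_int (x i h))}"

lemma affineI:
  "(\<And>h. h \<in> carrier G \<Longrightarrow> f h = \<alpha> + (\<Sum>i\<in>{..2 * m}. \<beta> i * of_int (x i h)))
      \<Longrightarrow> restrict f (carrier G) \<in> affine"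
  by (auto simp: affine_def)

lemma subspace_affine: "subspace QQ affine (dual_module G)"
proof (intro subspace.intro submodule.intro)
  show "vectorspace QQ (dual_module G)" by (rule vectorspace_dual_module)
  then show "module QQ (dual_module G)" by (rule vectorspace.axioms)
  show "affine \<subseteq> carrier (dual_module G)" by (auto simp: affine_def)
  fix f g assume "f \<in> affine" "g \<in> affine"
  then obtain \<alpha> \<beta> \<alpha>' \<beta>' where
    "\<forall>h\<in>carrier G. f h = \<alpha> + (\<Sum>i\<in>{..2 * m}. \<beta> i * of_int (x i h))"
    "\<forall>h\<in>carrier G. g h = \<alpha>' + (\<Sum>i\<in>{..2 * m}. \<beta>' i * of_int (x i h))"
    by (auto simp: affine_def)
  then show "f \<oplus>\<^bsub>dual_module G\<^esub> g \<in> affine"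
    by (auto simp: distrib_right sum.distrib intro!: affineI[of _ "\<alpha> + \<alpha>'" "\<lambda>i. \<beta> i + \<beta>' i"])
next
  show "\<zero>\<^bsub>dual_module G\<^esub> \<in> affine"
    by (auto intro!: affineI[of _ 0 "\<lambda>i. 0"])
  fix q :: rat and f assume "f \<in> affine"
  then obtain \<alpha> \<beta> where "\<forall>h\<in>carrier G. f h = \<alpha> + (\<Sum>i\<in>{..2 * m}. \<beta> i * of_int (x i h))"
    by (auto simp: affine_def)
  then show "q \<odot>\<^bsub>dual_module G\<^esub> f \<in> affine"
    by (auto simp: distrib_left sum_distrib_left mult.assoc intro!: affineI[of _ "q * \<alpha>"
        "\<lambda>i. q * \<beta> i"])
qed

text \<open>Right translation by the fixed \<open>inv g\<close> shifts the homomorphic coordinates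
  by constants; in the cross term of the last one the factor from \<open>inv g\<close> is constant,
  so the term is linear in \<open>h\<close>.\<close>

lemma dual_act_affine:
  assumes g: "g \<in> carrier G" and f: "f \<in> affine"
  shows "dual_act G g f \<in> affine"
proof -
  obtain \<alpha> \<beta> where f: "\<And>h. h \<in> carrier G \<Longrightarrow> f h = \<alpha> + (\<Sum>i\<in>{..2 * m}. \<beta> i * of_int (x i h))"
    using f by (auto simp: affine_def)
  let ?u = "inv g"
  \<comment> \<open>The factor \<open>x (m + k) h\<close> of the cross term is accompanied by the
    constant \<open>x k ?u\<close>, so coefficient i = m + k changes by that constant times
    \<open>\<beta> (2 * m)\<close>.\<close>
  let ?\<gamma> = "\<lambda>i. \<beta> i - (if m \<le> i \<and> i < 2 * m then \<beta> (2 * m) * of_int (x (i - m) ?u) else 0)"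
  show ?thesis
    unfolding dual_act_def
  proof (rule affineI)
    fix h assume h: "h \<in> carrier G"
    have mult: "of_int (x i (h \<otimes> ?u)) = (of_int (x i h + x i ?u) :: rat)" if "i < 2 * m" for i
      using x_mult[OF that h] g by simp
    have last: "of_int (x (2 * m) (h \<otimes> ?u)) =
        (of_int (x (2 * m) h + x (2 * m) ?u) - (\<Sum>i<m. of_int (x (m
            + i) h) * of_int (x i ?u)) :: rat)"
      using x_last_mult[OF h, of ?u] g by simp
    have "(\<Sum>i\<in>{..2 * m}. (if m \<le> i \<and> i < 2 * m then \<beta> (2 * m) * of_int (x (i - m) ?u) else 0) * of_int (x i h))
        = (\<Sum>i\<in>{m..<2 * m}. \<beta> (2 * m) * of_int (x (i - m) ?u) * of_int (x i h))"
      by (rule sum.mono_neutral_cong_right) auto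
    also have "\<dots> = (\<Sum>i<m. \<beta> (2 * m) * of_int (x i ?u) * of_int (x (m + i) h))"
      using m by (simp add: sum.atLeastLessThan_shift_0[of _ m] lessThan_atLeast0 add.commute)
    also have "\<dots> = \<beta> (2 * m) * (\<Sum>i<m. of_int (x (m + i) h) * of_int (x i ?u))"
      by (simp add: sum_distrib_left mult_ac)
    finally have cross: "(\<Sum>i\<in>{..2 * m}. (if m \<le> i \<and> i < 2 * m then \<beta> (2 * m) * of_int (x (i - m) ?u) else 0) * of_int (x i h))
       = \<beta> (2 * m) * (\<Sum>i<m. of_int (x (m + i) h) * of_int (x i ?u))" .
    have "(\<Sum>i\<in>{..2 * m}. \<beta> i * of_int (x i (h \<otimes> ?u))) =
       (\<Sum>i<2 * m. \<beta> i * of_int (x i h + x i ?u)) + \<beta> (2 * m) * of_int (x (2 * m) (h \<otimes> ?u))"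
      by (simp add: mult flip: lessThan_Suc_atMost)
    also have "\<dots> = (\<Sum>i\<in>{..2 * m}. \<beta> i * of_int (x i h + x i ?u)) -
        \<beta> (2 * m) * (\<Sum>i<m. of_int (x (m + i) h) * of_int (x i ?u))"
      by (simp add: last flip: lessThan_Suc_atMost) (simp add: algebra_simps)
    finally show "f (h \<otimes> ?u) = \<alpha> + (\<Sum>i\<in>{..2 * m}. \<beta> i * of_int (x i ?u))
        + (\<Sum>i\<in>{..2 * m}. ?\<gamma> i * of_int (x i h))"
      using g h unfolding left_diff_distrib sum_subtractf cross
      by (simp add: f sum.distrib distrib_left)
  qed
qed

lemma coord_fun_affine: "i \<le> 2 * m \<Longrightarrow> coord_fun G bs i \<in> affine"
  unfolding coord_fun
  by (rule affineI[of _ 0 "\<lambda>j. of_bool (i = j)"])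
      (simp add: of_bool_def if_distrib[of "\<lambda>t. t * _"] cong: if_cong)

text \<open>The coordinates are generators, so only the constants need an argument: 1 is the
  difference of coordinate 0 and its translate by \<open>a 0\<close>.\<close>

lemma affine_minimal:
  assumes W: "subspace QQ W (dual_module G)"
    and inv: "\<And>g f. g \<in> carrier G \<Longrightarrow> f \<in> W \<Longrightarrow> dual_act G g f \<in> W"
    and coord: "\<And>i. i \<le> 2 * m \<Longrightarrow> coord_fun G bs i \<in> W"
  shows "affine \<subseteq> W"
proof
  interpret W: submodule QQ W "dual_module G" using W by (rule subspace.submod)
  have add: "(\<lambda>h\<in>carrier G. f h + f' h) \<in> W" if "f \<in> W" "f' \<in> W" for f f'
    using W.m_closed[OF that] by simp
  have scale: "(\<lambda>h\<in>carrier G. q * f h) \<in> W" if "f \<in> W" for f q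
    using W.smult_closed[OF _ that, of q] by simp
  have x: "(\<lambda>h\<in>carrier G. of_int (x i h)) \<in> W" if "i \<le> 2 * m" for i
    using coord[OF that] coord_fun[OF that] by simp
  have "x 0 (h \<otimes> inv (a 0)) = x 0 h - 1" if "h \<in> carrier G" for h
    using additive_inv[of "x 0" "a 0"] m that by (simp add: x_mult a_closed x_a)
  then have "dual_act G (a 0) (\<lambda>h\<in>carrier G. of_int (x 0 h)) = (\<lambda>h\<in>carrier G. of_int (x 0 h) - 1)"
    using a_closed[of 0] by (auto simp: dual_act_def)
  then have "(\<lambda>h\<in>carrier G. of_int (x 0 h) - 1) \<in> W"
    using inv[OF _ x, of "a 0" 0] a_closed[of 0] by simp
  from add[OF x[of 0] scale[OF this, of "- 1"]] have "(\<lambda>h\<in>carrier G. 1) \<in> W"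
    by (simp cong: restrict_cong)
  have const: "(\<lambda>h\<in>carrier G. \<alpha>) \<in> W" for \<alpha>
  proof -
    have "(\<lambda>h\<in>carrier G. \<alpha> * (\<lambda>h\<in>carrier G. 1) h) = (\<lambda>h\<in>carrier G. \<alpha>)" by (rule restrict_ext) simp
    then show ?thesis using scale[OF \<open>(\<lambda>h\<in>carrier G. 1) \<in> W\<close>, of \<alpha>] by simp
  qed
  fix f assume "f \<in> affine"
  then obtain \<alpha> \<beta> where f: "f \<in> extensional (carrier G)"
     "\<forall>h\<in>carrier G. f h = \<alpha> + (\<Sum>i\<in>{..2 * m}. \<beta> i * of_int (x i h))"
    by (auto simp: affine_def)
  have "(\<lambda>h\<in>carrier G. \<alpha> + (\<Sum>i\<in>S. \<beta> i * of_int (x i h))) \<in> W" if "finite S" "S \<subseteq> {..2 * m}" for S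
    using that
  proof (induction S rule: finite_induct)
    case empty show ?case by (simp only: sum.empty add_0_right const)
  next
    case (insert i S)
    have "(\<lambda>h\<in>carrier G. \<beta> i * of_int (x i h)) \<in> W"
      using scale[OF x[of i], of "\<beta> i"] insert.prems by (simp cong: restrict_cong)
    moreover have "S \<subseteq> {..2 * m}" using insert.prems by simp
    ultimately have "(\<lambda>h\<in>carrier G. (\<lambda>h\<in>carrier G. \<alpha> + (\<Sum>i\<in>S. \<beta> i * of_int (x i h))) h
        + (\<lambda>h\<in>carrier G. \<beta> i * of_int (x i h)) h) \<in> W"
      by (intro add insert.IH)
    also have "(\<lambda>h\<in>carrier G. (\<lambda>h\<in>carrier G. \<alpha> + (\<Sum>i\<in>S. \<beta> i * of_int (x i h))) h
        + (\<lambda>h\<in>carrier G. \<beta> i * of_int (x i h)) h)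
        = (\<lambda>h\<in>carrier G. \<alpha> + (\<Sum>i\<in>insert i S. \<beta> i * of_int (x i h)))"
      by (rule restrict_ext) (simp add: insert.hyps)
    finally show ?case .
  qed
  from this[of "{..2 * m}"] have "(\<lambda>h\<in>carrier G. \<alpha>
      + (\<Sum>i\<in>{..2 * m}. \<beta> i * of_int (x i h))) \<in> W" by simp
  also have "(\<lambda>h\<in>carrier G. \<alpha> + (\<Sum>i\<in>{..2 * m}. \<beta> i * of_int (x i h))) = f"
    using f by (auto simp: extensional_def)
  finally show "f \<in> W" .
qed

text \<open>\<open>affine\<close> is one of the intersected subspaces and by
  \<open>affine_minimal\<close> lies inside each of them.\<close>

lemma nickel_module: "nickel_module G bs = (dual_module G)\<lparr>carrier := affine\<rparr>"
proof -
  have "\<Inter>{W. subspace QQ W (dual_module G) \<and> (\<forall>g \<in> carrier G. \<forall>f \<in> W. dual_act G g f \<in> W) \<and>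
        (\<forall>i < length bs. coord_fun G bs i \<in> W)} = affine"
  proof
    show "affine \<subseteq> \<Inter>{W. subspace QQ W (dual_module G) \<and> (\<forall>g
        \<in> carrier G. \<forall>f \<in> W. dual_act G g f \<in> W) \<and>
        (\<forall>i < length bs. coord_fun G bs i \<in> W)}"
      by (rule Inter_greatest, rule affine_minimal) auto
  qed (rule Inter_lower, use subspace_affine dual_act_affine coord_fun_affine in auto)
  then show ?thesis unfolding nickel_module_def by simp
qed

lemma dim_nickel_module:
  "vectorspace QQ (nickel_module G bs) \<and> vectorspace.fin_dim QQ (nickel_module G bs) \<and>
   vectorspace.dim QQ (nickel_module G bs) = 2 * m + 2"
proof -
  let ?N = "(dual_module G)\<lparr>carrier := affine\<rparr>"
  let ?I = "insert None (Some ` {..2 * m})"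
  \<comment> \<open>\<open>None\<close> indexes the constant function and \<open>Some i\<close> a
    coordinate; the dual functionals are the value at the identity and the first difference at
    \<open>a i\<close>.\<close>
  define e where "e = case_option (\<lambda>h\<in>carrier G. 1) (\<lambda>i. \<lambda>h\<in>carrier G. of_int (x i h) :: rat)"
  define \<phi> :: "nat option \<Rightarrow> ('a \<Rightarrow> rat) \<Rightarrow> rat" where "\<phi>
      = case_option (\<lambda>f. f \<one>) (\<lambda>i f. f (a i) - f \<one>)"
  interpret D: vectorspace QQ "dual_module G" by (rule vectorspace_dual_module)
  interpret N: vectorspace QQ ?N
    using subspace_affine by (rule D.subspace_is_vs)
  have N_simps: "carrier ?N = affine" "f \<oplus>\<^bsub>?N\<^esub> g = (\<lambda>h\<in>carrier G. f h + g h)"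
    "\<zero>\<^bsub>?N\<^esub> = (\<lambda>h\<in>carrier G. 0)" "q \<odot>\<^bsub>?N\<^esub> f = (\<lambda>h\<in>carrier G. q * f h)" for f g q
    by simp_all
  have e: "e i \<in> affine" if "i \<in> ?I" for i
    using that coord_fun_affine coord_fun by (auto simp: e_def intro!: affineI[of _ 1 "\<lambda>i. 0"])
  have finsum: "(\<Oplus>\<^bsub>?N\<^esub>i\<in>S. c i \<odot>\<^bsub>?N\<^esub> e i) = (\<lambda>h\<in>carrier G. \<Sum>i\<in>S. c i * e i h)"
      if "finite S" "S \<subseteq> ?I" for S c
    using that
  proof (induction S rule: finite_induct)
    case empty show ?case by (simp only: N.M.finsum_empty N_simps sum.empty)
  next
    case (insert i S)
    have "c j \<odot>\<^bsub>?N\<^esub> e j \<in> carrier ?N" if "j \<in> insert i S" for j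
      using subsetD[OF insert.prems that] e[of j] N.smult_closed[of "c j" "e j"] by simp
    then have "(\<Oplus>\<^bsub>?N\<^esub>i\<in>insert i S. c i \<odot>\<^bsub>?N\<^esub> e i) = c i \<odot>\<^bsub>?N\<^esub> e i \<oplus>\<^bsub>?N\<^esub> (\<Oplus>\<^bsub>?N\<^esub>i\<in>S. c i \<odot>\<^bsub>?N\<^esub> e i)"
      using insert by (intro N.M.finsum_insert) auto
    also have "\<dots> = (\<lambda>h\<in>carrier G. (\<lambda>h\<in>carrier G. c i * e i h) h
        + (\<lambda>h\<in>carrier G. \<Sum>i\<in>S. c i * e i h) h)"
      using insert.prems by (subst insert.IH) (auto simp only: N_simps)
    also have "\<dots> = (\<lambda>h\<in>carrier G. \<Sum>i\<in>insert i S. c i * e i h)"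
      by (rule restrict_ext) (simp add: insert.hyps)
    finally show ?case .
  qed
  have "N.fin_dim \<and> N.dim = card ?I"
  proof (rule N.dim_dual_family[where e = e and \<phi> = \<phi>])
    fix f assume "f \<in> carrier ?N"
    then obtain \<alpha> \<beta> where f: "f \<in> extensional (carrier G)"
      "\<And>h. h \<in> carrier G \<Longrightarrow> f h = \<alpha> + (\<Sum>i\<in>{..2 * m}. \<beta> i * of_int (x i h))"
      by (auto simp: affine_def N_simps)
    have 1: "f \<one> = \<alpha>" by (simp add: f x_one)
    have 2: "f (a i) - f \<one> = \<beta> i" if "i \<le> 2 * m" for i
    proof -
      have "(\<Sum>j\<in>{..2 * m}. \<beta> j * of_int (x j (a i))) = (\<Sum>j\<in>{..2 * m}. if i = j then \<beta> j else 0)"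
        using that by (intro sum.cong) (auto simp: x_a)
      then show ?thesis using that by (simp add: 1) (simp add: f a_closed)
    qed
    have "(\<Sum>i\<in>?I. \<phi> i f * e i h) = f h" if "h \<in> carrier G" for h
      using that by (subst sum.insert) (auto simp: sum.reindex \<phi>_def e_def 1 2[unfolded 1] f(2)[OF that] intro!: sum.cong)
    then show "(\<Oplus>\<^bsub>?N\<^esub>i\<in>?I. \<phi> i f \<odot>\<^bsub>?N\<^esub> e i) = f"
      using f(1) by (subst finsum) (auto simp: extensional_def)
  qed (use e in \<open>auto simp: N_simps \<phi>_def e_def x_one x_a a_closed algebra_simps\<close>)
  also have "card ?I = 2 * m + 2"
    by (subst card_insert_disjoint) (auto simp: card_image)
  finally show ?thesis unfolding nickel_module using N.vectorspace_axioms by simp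
qed

end

section \<open>The Heisenberg group\<close>

lemma index_mult_mat_sum:
  assumes "A \<in> carrier_mat d d" "B \<in> carrier_mat d d" "i < d" "j < d"
  shows "(A * B) $$ (i, j) = (\<Sum>k<d. A $$ (i, k) * B $$ (k, j))"
  using assms by (auto simp: scalar_prod_def lessThan_atLeast0 intro!: sum.cong)

lemma unitriangular_group_simps [simp]:
  "A \<otimes>\<^bsub>unitriangular_group d\<^esub> B = A * B" "\<one>\<^bsub>unitriangular_group d\<^esub> = 1\<^sub>m d"
  by (simp_all add: unitriangular_group_def)

lemma unitriangular_groupD:
  assumes "A \<in> carrier (unitriangular_group d)"
  shows "A \<in> carrier_mat d d" "j < i \<Longrightarrow> i < d \<Longrightarrow> A $$ (i, j) = 0" "i < d \<Longrightarrow> A $$ (i, i) = 1"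
  using assms by (auto simp: unitriangular_group_def upper_triangular_def)

lemma unitriangular_groupI:
  assumes "A \<in> carrier_mat d d" "\<And>i j. j < i \<Longrightarrow> i < d \<Longrightarrow> A $$ (i, j) = 0" "\<And>i. i < d
      \<Longrightarrow> A $$ (i, i) = 1"
  shows "A \<in> carrier (unitriangular_group d)"
  using assms by (auto simp: unitriangular_group_def upper_triangular_def)

text \<open>A nonzero summand of a product entry needs i \<le> k \<le> j, so on the diagonal only k
  = i remains and below it nothing. Inverses come later, in closed form, for Heisenberg
  matrices.\<close>

lemma monoid_unitriangular_group: "Group.monoid (unitriangular_group d)"
proof (rule monoidI)
  fix A B assume A: "A \<in> carrier (unitriangular_group d)"
      and B: "B \<in> carrier (unitriangular_group d)"
  note C = unitriangular_groupD[OF A] unitriangular_groupD[OF B]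
  have "(A * B) $$ (i, j) = of_bool (i = j)" if "j \<le> i" "i < d" for i j
  proof -
    have "(A * B) $$ (i, j) = (\<Sum>k<d. A $$ (i, k) * B $$ (k, j))"
      using C that by (intro index_mult_mat_sum) auto
    also have "\<dots> = (\<Sum>k<d. if k = i then of_bool (i = j) else 0)"
    proof (rule sum.cong[OF refl])
      fix k assume "k \<in> {..<d}"
      then show "A $$ (i, k) * B $$ (k, j) = (if k = i then of_bool (i = j) else 0)"
        using C that by (cases "k < i"; cases "k = i"; cases "i = j") auto
    qed
    finally show ?thesis using that by simp
  qed
  then show "A \<otimes>\<^bsub>unitriangular_group d\<^esub> B \<in> carrier (unitriangular_group d)"
    using C by (intro unitriangular_groupI) auto
next
  fix A B C assume "A \<in> carrier (unitriangular_group d)" "B \<in> carrier (unitriangular_group d)" "C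
      \<in> carrier (unitriangular_group d)"
  note unitriangular_groupD(1)[OF this(1)] unitriangular_groupD(1)[OF this(2)] unitriangular_groupD(1)[OF this(3)]
  then show "A \<otimes>\<^bsub>unitriangular_group d\<^esub> B \<otimes>\<^bsub>unitriangular_group d\<^esub> C
      = A \<otimes>\<^bsub>unitriangular_group d\<^esub> (B \<otimes>\<^bsub>unitriangular_group d\<^esub> C)" by simp
qed (auto intro!: unitriangular_groupI dest: unitriangular_groupD(1))

text \<open>Counting from 0, the free entries are those of row 0 and column m + 1 apart from the two
  on the diagonal.\<close>

definition heisenberg_mat :: "nat \<Rightarrow> int mat \<Rightarrow> bool" where
  "heisenberg_mat m A \<longleftrightarrow> A \<in> carrier_mat (m + 2) (m + 2) \<and> A $$ (0, 0) = 1 \<and> A $$ (m + 1, m + 1)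
      = 1 \<and>
     (\<forall>k l. 1 \<le> k \<longrightarrow> k \<le> m + 1 \<longrightarrow> l \<le> m \<longrightarrow> A $$ (k, l) = of_bool (k = l))"

text \<open>In the product of generator powers the first two blocks contribute the dot product of
  their exponents to the corner entry; subtracting it leaves the last Mal'cev exponent.\<close>

definition heisenberg_coord :: "nat \<Rightarrow> nat \<Rightarrow> int mat \<Rightarrow> int" where
  "heisenberg_coord m i A =
    (if i < m then A $$ (0, i + 1) else if i < 2 * m then A $$ (i - m + 1, m + 1)
     else A $$ (0, m + 1) - (\<Sum>i<m. A $$ (0, i + 1) * A $$ (i + 1, m + 1)))"

text \<open>The inner block is an identity matrix, so the free entries add, except that the corner
  also gains the first row of \<open>A\<close> times the last column of \<open>B\<close>.\<close>

lemma heisenberg_mat_mult: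
  assumes A: "heisenberg_mat m A" and B: "heisenberg_mat m B"
  shows "heisenberg_mat m (A * B)"
    and "1 \<le> l \<Longrightarrow> l \<le> m \<Longrightarrow> (A * B) $$ (0, l) = A $$ (0, l) + B $$ (0, l)"
    and "1 \<le> k \<Longrightarrow> k \<le> m \<Longrightarrow> (A * B) $$ (k, m + 1) = A $$ (k, m + 1) + B $$ (k, m + 1)"
    and "(A * B) $$ (0, m + 1) = A $$ (0, m + 1) + B $$ (0, m + 1) + (\<Sum>i<m. A $$ (0, i
        + 1) * B $$ (i + 1, m + 1))"
proof -
  have C: "A \<in> carrier_mat (m + 2) (m + 2)" "B \<in> carrier_mat (m + 2) (m + 2)"
    and A': "A $$ (0, 0) = 1" "A $$ (Suc m, Suc m) = 1" "\<And>k l. k \<le> m \<Longrightarrow> l \<le> m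
        \<Longrightarrow> A $$ (Suc k, l) = of_bool (Suc k = l)"
    and B': "B $$ (0, 0) = 1" "B $$ (Suc m, Suc m) = 1" "\<And>k l. k \<le> m \<Longrightarrow> l \<le> m
        \<Longrightarrow> B $$ (Suc k, l) = of_bool (Suc k = l)"
    using A B by (auto simp: heisenberg_mat_def)
  have sum: "(A * B) $$ (k, l) = A $$ (k, 0) * B $$ (0, l)
      + (\<Sum>i<m. A $$ (k, Suc i) * B $$ (Suc i, l))
      + A $$ (k, Suc m) * B $$ (Suc m, l)" if "k \<le> m + 1" "l \<le> m + 1" for k l
  proof -
    have "(\<Sum>i<m + 2. f i) = f 0 + (\<Sum>i<m. f (Suc i)) + f (Suc m)" for f :: "nat \<Rightarrow> int"
      by (subst add_2_eq_Suc', subst sum.lessThan_Suc, subst sum.lessThan_Suc_shift) simp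
    then show ?thesis using that index_mult_mat_sum[OF C, of k l] by simp
  qed
  have delta: "(\<Sum>i<m. f i * of_bool (Suc i = l)) = (if 1 \<le> l \<and> l \<le> m then f (l - 1) else 0)"
    "(\<Sum>i<m. of_bool (l = Suc i) * f i) = (if 1 \<le> l \<and> l \<le> m then f (l - 1) else 0)"
        for f :: "nat \<Rightarrow> int" and l
    by (cases l; simp add: of_bool_def if_distrib[of "\<lambda>t. t * _"] if_distrib[of
        "\<lambda>t. _ * t"] cong: if_cong)+
  show top: "(A * B) $$ (0, l) = A $$ (0, l) + B $$ (0, l)" if "1 \<le> l" "l \<le> m" for l
    using that by (simp add: sum A' B' delta)
  show "(A * B) $$ (k, m + 1) = A $$ (k, m + 1) + B $$ (k, m + 1)" if "1 \<le> k" "k \<le> m" for k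
    using that by (cases k) (simp_all add: sum A' B' delta)
  show "(A * B) $$ (0, m + 1) = A $$ (0, m + 1) + B $$ (0, m + 1) + (\<Sum>i<m. A $$ (0, i
      + 1) * B $$ (i + 1, m + 1))"
    by (simp add: sum A' B')
  have "(A * B) $$ (Suc k, l) = of_bool (Suc k = l)" if "k \<le> m" "l \<le> m" for k l
    using that by (cases "k = m") (auto simp: sum A' B' delta)
  moreover have "(A * B) $$ (0, 0) = 1" by (simp add: sum A' B')
  moreover have "(A * B) $$ (m + 1, m + 1) = 1" by (simp add: sum A' B')
  ultimately show "heisenberg_mat m (A * B)"
    using C by (auto simp: heisenberg_mat_def Suc_le_eq gr0_conv_Suc)
qed

text \<open>The corner is recovered last, because its coordinate subtracts a dot product of the
  other entries.\<close>

lemma heisenberg_mat_eqI: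
  assumes A: "heisenberg_mat m A" and B: "heisenberg_mat m B"
    and "\<And>i. i \<le> 2 * m \<Longrightarrow> heisenberg_coord m i A = heisenberg_coord m i B"
  shows "A = B"
proof -
  have top: "A $$ (0, i + 1) = B $$ (0, i + 1)" if "i < m" for i
    using assms(3)[of i] that by (simp add: heisenberg_coord_def)
  have right: "A $$ (i + 1, m + 1) = B $$ (i + 1, m + 1)" if "i < m" for i
    using assms(3)[of "m + i"] that by (simp add: heisenberg_coord_def)
  have corner: "A $$ (0, m + 1) = B $$ (0, m + 1)"
    using assms(3)[of "2 * m"] top right by (simp add: heisenberg_coord_def)
  show ?thesis
  proof (rule eq_matI)
    fix k l assume "k < dim_row B" "l < dim_col B"
    then have kl: "k \<le> m + 1" "l \<le> m + 1" using B by (auto simp: heisenberg_mat_def)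
    show "A $$ (k, l) = B $$ (k, l)"
    proof (cases k)
      case 0
      consider "l = 0" | i where "l = i + 1" "i < m" | "l = m + 1" using kl by (cases l) force+
      then show ?thesis using 0 A B top corner by cases (auto simp: heisenberg_mat_def)
    next
      case (Suc i)
      then consider "l \<le> m" | "l = m + 1" "i < m" | "l = m + 1" "k = m + 1" using kl by force
      then show ?thesis using Suc kl A B right by cases (auto simp: heisenberg_mat_def)
    qed
  qed (use A B in \<open>auto simp: heisenberg_mat_def\<close>)
qed

text \<open>The corner gains (top of A)(right of B). The subtracted dot product gains this and (top
  of B)(right of A), so the latter survives with a minus sign.\<close>

lemma heisenberg_coord_mult:
  assumes A: "heisenberg_mat m A" and B: "heisenberg_mat m B"
  shows "i < 2 * m \<Longrightarrow> heisenberg_coord m i (A * B) = heisenberg_coord m i A + heisenberg_coord m i B"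
    and "heisenberg_coord m (2 * m) (A * B) = heisenberg_coord m (2 * m) A
        + heisenberg_coord m (2 * m) B
      - (\<Sum>i<m. heisenberg_coord m (m + i) A * heisenberg_coord m i B)"
proof -
  note mult = heisenberg_mat_mult(2-)[OF A B]
  show "heisenberg_coord m i (A * B) = heisenberg_coord m i A + heisenberg_coord m i B"
      if "i < 2 * m"
    using that mult(1)[of "i + 1"] mult(2)[of "i - m + 1"] by (auto simp: heisenberg_coord_def)
  have "(\<Sum>i<m. (A * B) $$ (0, i + 1) * (A * B) $$ (i + 1, m + 1)) =
      (\<Sum>i<m. (A $$ (0, i + 1) + B $$ (0, i + 1)) * (A $$ (i + 1, m + 1) + B $$ (i + 1, m + 1)))"
    by (rule sum.cong[OF refl]) (use mult(1) mult(2) in auto)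
  moreover have "(\<Sum>i<m. heisenberg_coord m (m + i) A * heisenberg_coord m i B)
      = (\<Sum>i<m. A $$ (i + 1, m + 1) * B $$ (0, i + 1))"
    by (rule sum.cong[OF refl]) (simp add: heisenberg_coord_def)
  ultimately show "heisenberg_coord m (2 * m) (A * B)
      = heisenberg_coord m (2 * m) A + heisenberg_coord m (2 * m) B
      - (\<Sum>i<m. heisenberg_coord m (m + i) A * heisenberg_coord m i B)"
    using mult(3) by (simp add: heisenberg_coord_def) (simp add: sum.distrib algebra_simps)
qed

lemma heisenberg_mat_one: "heisenberg_mat m (1\<^sub>m (m + 2))"
  by (auto simp: heisenberg_mat_def)

lemma heisenberg_coord_one: "i \<le> 2 * m \<Longrightarrow> heisenberg_coord m i (1\<^sub>m (m + 2)) = 0"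
  by (auto simp: heisenberg_coord_def)

lemma heisenberg_mat_inverse:
  assumes A: "heisenberg_mat m A"
  obtains B where "heisenberg_mat m B" "A * B = 1\<^sub>m (m + 2)" "B * A = 1\<^sub>m (m + 2)"
proof -
  \<comment> \<open>With N = A - 1 one has N^3 = 0, so the inverse is 1 - N + N^2, where N^2 is
    supported in the corner.\<close>
  define B where "B = mat (m + 2) (m + 2) (\<lambda>(k, l). if k = l then 1
    else if k = 0 \<and> l = m + 1 then - A $$ (0, m + 1) + (\<Sum>i<m. A $$ (0, i + 1) * A $$ (i + 1, m + 1))
    else if k = 0 \<or> l = m + 1 then - A $$ (k, l) else 0)"
  have B: "heisenberg_mat m B" by (auto simp: heisenberg_mat_def B_def)
  have coord: "heisenberg_coord m i B = - heisenberg_coord m i A" if "i < 2 * m" for i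
    using that by (auto simp: heisenberg_coord_def B_def)
  have last: "heisenberg_coord m (2 * m) B = - heisenberg_coord m (2 * m) A
      - (\<Sum>i<m. heisenberg_coord m (m + i) A * heisenberg_coord m i A)"
    by (simp add: heisenberg_coord_def B_def sum_negf mult.commute)
  have "A * B = 1\<^sub>m (m + 2)"
  proof (rule heisenberg_mat_eqI[OF heisenberg_mat_mult(1)[OF A B] heisenberg_mat_one])
    show "heisenberg_coord m i (A * B) = heisenberg_coord m i (1\<^sub>m (m + 2))" if "i \<le> 2 * m" for i
      using that by (cases "i = 2 * m")
        (simp_all add: heisenberg_coord_one[simplified] heisenberg_coord_mult[OF A B] coord last sum_negf)
  qed
  moreover have "B * A = 1\<^sub>m (m + 2)"
  proof (rule heisenberg_mat_eqI[OF heisenberg_mat_mult(1)[OF B A] heisenberg_mat_one])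
    show "heisenberg_coord m i (B * A) = heisenberg_coord m i (1\<^sub>m (m + 2))" if "i \<le> 2 * m" for i
      using that by (cases "i = 2 * m")
        (simp_all add: heisenberg_coord_one[simplified] heisenberg_coord_mult[OF B A] coord last sum_negf)
  qed
  ultimately show ?thesis using that B by blast
qed

lemma heisenberg_mat_unitriangular:
  assumes "heisenberg_mat m A" shows "A \<in> carrier (unitriangular_group (m + 2))"
proof (rule unitriangular_groupI)
  fix i j assume "j < i" "i < m + 2"
  then show "A $$ (i, j) = 0" using assms by (auto simp: heisenberg_mat_def)
next
  fix i assume "i < m + 2"
  then show "A $$ (i, i) = 1" using assms by (cases "i = 0"; cases "i = m + 1")
      (auto simp: heisenberg_mat_def)
qed (use assms in \<open>simp add: heisenberg_mat_def\<close>)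

text \<open>Generators are numbered from 1 but coordinates from 0, so coordinate i belongs to
  generator i + 1; this shifts the matrix positions.\<close>

lemma heis_gen_cases:
  assumes "i \<le> 2 * m"
  obtains "i < m" "heis_gen m (Suc i) = transvection (m + 2) 1 (i + 2)"
  | "m \<le> i" "i < 2 * m" "heis_gen m (Suc i) = transvection (m + 2) (i - m + 2) (m + 2)"
  | "i = 2 * m" "heis_gen m (Suc i) = transvection (m + 2) 1 (m + 2)"
  using assms by (cases "i < m"; cases "i < 2 * m") (auto simp: heis_gen_def Suc_diff_le)

lemma heisenberg_mat_heis_gen:
  assumes "i \<le> 2 * m" shows "heisenberg_mat m (heis_gen m (Suc i))"
  using assms by (cases rule: heis_gen_cases)
    (auto simp: heisenberg_mat_def transvection_def matrix_unit_def)

lemma heisenberg_coord_heis_gen: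
  assumes "m \<ge> 1" "i \<le> 2 * m" "j \<le> 2 * m"
  shows "heisenberg_coord m i (heis_gen m (Suc j)) = of_bool (i = j)"
  using assms(3)
proof (cases rule: heis_gen_cases)
  case 1
  then show ?thesis using assms(1,2)
    by (auto simp: heisenberg_coord_def transvection_def matrix_unit_def)
next
  case 2
  then show ?thesis using assms(1,2)
    by (auto simp: heisenberg_coord_def transvection_def matrix_unit_def)
next
  case 3
  then show ?thesis using assms(1,2)
    by (auto simp: heisenberg_coord_def transvection_def matrix_unit_def)
qed

section \<open>The generated group and its coordinates\<close>

lemma heis_basis_eq: "heis_basis m = map (\<lambda>i. heis_gen m (Suc i)) [0..<2 * m + 1]"
proof -
  have "[1..<2 * m + 2] = map Suc [0..<2 * m + 1]" by (simp add: map_Suc_upt del: upt_Suc)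
  then show ?thesis unfolding heis_basis_def by (simp add: comp_def del: upt_Suc)
qed

lemma heisenberg_group_simps [simp]:
  "A \<otimes>\<^bsub>heisenberg_group m\<^esub> B = A * B" "\<one>\<^bsub>heisenberg_group m\<^esub> = 1\<^sub>m (m + 2)"
  by (simp_all add: heisenberg_group_def subgroup_generated_def)

lemma set_heis_basis: "A \<in> set (heis_basis m) \<Longrightarrow> heisenberg_mat m A"
  by (auto simp: heis_basis_eq heisenberg_mat_heis_gen simp del: upt_Suc)

lemma carrier_heisenberg_group:
  "carrier (heisenberg_group m) = generate (unitriangular_group (m + 2)) (set (heis_basis m))"
proof -
  have "carrier (unitriangular_group (m + 2)) \<inter> set (heis_basis m) = set (heis_basis m)"
    using heisenberg_mat_unitriangular set_heis_basis by blast
  then show ?thesis by (simp add: heisenberg_group_def carrier_subgroup_generated)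
qed

lemma inv_unitriangular_group:
  assumes "A * B = 1\<^sub>m (m + 2)" "B * A = 1\<^sub>m (m + 2)" "heisenberg_mat m A" "heisenberg_mat m B"
  shows "inv\<^bsub>unitriangular_group (m + 2)\<^esub> A = B"
  using assms heisenberg_mat_unitriangular
  by (intro monoid.inv_char[OF monoid_unitriangular_group]) auto

lemma heisenberg_group_mat: "A \<in> carrier (heisenberg_group m) \<Longrightarrow> heisenberg_mat m A"
  unfolding carrier_heisenberg_group
proof (induction A rule: generate.induct)
  case (inv h)
  obtain B where B: "heisenberg_mat m B" "h * B = 1\<^sub>m (m + 2)" "B * h = 1\<^sub>m (m + 2)"
    using set_heis_basis[OF inv] heisenberg_mat_inverse by blast
  then show ?case using inv_unitriangular_group[OF B(2,3) set_heis_basis[OF inv] B(1)] by simp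
qed (auto simp: heisenberg_mat_one[simplified] set_heis_basis heisenberg_mat_mult)

text \<open>The ambient structure is at hand as a monoid, so the group axioms are verified directly;
  left inverses come by induction over \<open>generate\<close>, reversing the order for
  products.\<close>

lemma group_heisenberg_group: "group (heisenberg_group m)"
proof (rule groupI)
  have C: "A \<in> carrier_mat (m + 2) (m + 2)" if "A \<in> carrier (heisenberg_group m)" for A
    using heisenberg_group_mat[OF that] by (simp add: heisenberg_mat_def)
  show "A \<otimes>\<^bsub>heisenberg_group m\<^esub> B \<in> carrier (heisenberg_group m)"
    if "A \<in> carrier (heisenberg_group m)" "B \<in> carrier (heisenberg_group m)" for A B
    using that generate.eng[of A "unitriangular_group (m + 2)" _ B]
        by (simp add: carrier_heisenberg_group)
  then have closed: "A * B \<in> carrier (heisenberg_group m)"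
    if "A \<in> carrier (heisenberg_group m)" "B \<in> carrier (heisenberg_group m)" for A B
    using that by simp
  show "\<one>\<^bsub>heisenberg_group m\<^esub> \<in> carrier (heisenberg_group m)"
    using generate.one[of "unitriangular_group (m + 2)"] by (simp add: carrier_heisenberg_group)
  show "A \<otimes>\<^bsub>heisenberg_group m\<^esub> B \<otimes>\<^bsub>heisenberg_group m\<^esub> D
      = A \<otimes>\<^bsub>heisenberg_group m\<^esub> (B \<otimes>\<^bsub>heisenberg_group m\<^esub> D)"
    if "A \<in> carrier (heisenberg_group m)" "B \<in> carrier (heisenberg_group m)" "D
        \<in> carrier (heisenberg_group m)" for A B D
    using C[OF that(1)] C[OF that(2)] C[OF that(3)] by simp
  show "\<one>\<^bsub>heisenberg_group m\<^esub> \<otimes>\<^bsub>heisenberg_group m\<^esub> A = A" if "A \<in> carrier (heisenberg_group m)" for A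
    using C[OF that] by simp
  fix A assume "A \<in> carrier (heisenberg_group m)"
  then have "A \<in> generate (unitriangular_group (m + 2)) (set (heis_basis m))"
      by (simp add: carrier_heisenberg_group)
  then have "\<exists>B \<in> carrier (heisenberg_group m). B * A = 1\<^sub>m (m + 2)"
  proof (induction A rule: generate.induct)
    case one
    show ?case using generate.one[of "unitriangular_group (m + 2)"]
      by (intro bexI[of _ "1\<^sub>m (m + 2)"]) (auto simp: carrier_heisenberg_group)
  next
    case (incl h)
    obtain B where B: "heisenberg_mat m B" "h * B = 1\<^sub>m (m + 2)" "B * h = 1\<^sub>m (m + 2)"
      using set_heis_basis[OF incl] heisenberg_mat_inverse by blast
    have "B \<in> carrier (heisenberg_group m)"
      using generate.inv[OF incl, of "unitriangular_group (m + 2)"]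
        inv_unitriangular_group[OF B(2,3) set_heis_basis[OF incl] B(1)]
      by (simp add: carrier_heisenberg_group)
    with B show ?case by blast
  next
    case (inv h)
    obtain B where B: "heisenberg_mat m B" "h * B = 1\<^sub>m (m + 2)" "B * h = 1\<^sub>m (m + 2)"
      using set_heis_basis[OF inv] heisenberg_mat_inverse by blast
    then show ?case
      using generate.incl[OF inv] inv_unitriangular_group[OF B(2,3) set_heis_basis[OF inv] B(1)]
      by (auto simp: carrier_heisenberg_group)
  next
    case (eng A B)
    then obtain A' B' where AB: "A' \<in> carrier (heisenberg_group m)" "B'
        \<in> carrier (heisenberg_group m)"
      "A' * A = 1\<^sub>m (m + 2)" "B' * B = 1\<^sub>m (m + 2)" by blast
    have AB_C: "A \<in> carrier_mat (m + 2) (m + 2)" "B \<in> carrier_mat (m + 2) (m + 2)"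
      using eng C by (auto simp: carrier_heisenberg_group)
    have "B' * A' * (A * B) = B' * (A' * (A * B))" using C AB(1,2) AB_C
      by (intro assoc_mult_mat[of _ "m + 2" "m + 2" _ "m + 2" _ "m + 2"]) auto
    also have "A' * (A * B) = A' * A * B" using C AB(1,2) AB_C
      by (intro assoc_mult_mat[of _ "m + 2" "m + 2" _ "m + 2" _ "m + 2", symmetric]) auto
    also have "B' * (A' * A * B) = 1\<^sub>m (m + 2)" using AB AB_C by simp
    finally show ?case using closed[OF AB(2,1)] by auto
  qed
  then show "\<exists>B\<in>carrier (heisenberg_group m). B \<otimes>\<^bsub>heisenberg_group m\<^esub> A = \<one>\<^bsub>heisenberg_group m\<^esub>" by simp
qed

lemma heisenberg_coordinates:
  assumes "m \<ge> 1"
  shows "heisenberg_coordinates (heisenberg_group m) m (\<lambda>i. heis_gen m (Suc i)) (heisenberg_coord m)"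
proof (intro heisenberg_coordinates.intro heisenberg_coordinates_axioms.intro)
  show "heis_gen m (Suc i) \<in> carrier (heisenberg_group m)" if "i \<le> 2 * m" for i
    unfolding carrier_heisenberg_group heis_basis_eq using that
        by (intro generate.incl) (auto simp del: upt_Suc)
qed (use assms in \<open>auto simp: group_heisenberg_group heisenberg_group_mat heisenberg_coord_mult
  heisenberg_coord_heis_gen intro: heisenberg_mat_eqI[OF heisenberg_group_mat heisenberg_group_mat]\<close>)

text \<open>The rows are indexed by a basis of length \<open>d\<close>, so invariance of dimension
  fixes the size of the matrices.\<close>

lemma matrix_rep_dim:
  assumes "vectorspace QQ V" "matrix_rep G V act d \<rho>"
  shows "vectorspace.dim QQ V = d"
proof -
  interpret V: vectorspace QQ V by (rule assms(1))
  obtain bs where "length bs = d" "distinct bs" "V.basis (set bs)"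
    using assms(2) unfolding matrix_rep_def by blast
  then show ?thesis using V.dim_basis[of "set bs"] by (simp add: distinct_card)
qed

theorem theorem6p1:
  fixes m :: nat
  assumes "m \<ge> 1"
  shows
    "(vectorspace.fin_dim QQ (jennings_module (heisenberg_group m)) \<and>
      vectorspace.dim QQ (jennings_module (heisenberg_group m)) = 2 * m\<^sup>2 + 3 * m + 2) \<and>
     (vectorspace.fin_dim QQ (nickel_module (heisenberg_group m) (heis_basis m)) \<and>
      vectorspace.dim QQ (nickel_module (heisenberg_group m) (heis_basis m)) = 2 * m + 2) \<and>
     (\<forall>d \<rho> d' \<rho>'. jennings_embedding (heisenberg_group m) d \<rho> \<longrightarrow>
        nickel_embedding (heisenberg_group m) (heis_basis m) d' \<rho>' \<longrightarrow> d' < d)"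
proof -
  interpret heisenberg_coordinates "heisenberg_group m" m "\<lambda>i. heis_gen m (Suc i)"
      "heisenberg_coord m"
    using assms by (rule heisenberg_coordinates)
  \<comment> \<open>As the class is 2, the ideal in the definition is the third power of the
    augmentation ideal.\<close>
  have jennings: "jennings_module (heisenberg_group m) = V"
    unfolding jennings_module_def jennings_ideal_def cube_def nilpotency_class by simp
  note nickel = dim_nickel_module[folded heis_basis_eq]
  have "d' < d" if "jennings_embedding (heisenberg_group m) d \<rho>"
    "nickel_embedding (heisenberg_group m) (heis_basis m) d' \<rho>'" for d \<rho> d' \<rho>'
  proof -
    have "d = 2 * m\<^sup>2 + 3 * m + 2"
      using matrix_rep_dim[OF vectorspace_V] that(1) dim_quotient
      unfolding jennings_embedding_def jennings by metis
    moreover have "d' = 2 * m + 2"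
      using matrix_rep_dim that(2) nickel unfolding nickel_embedding_def by metis
    \<comment> \<open>The sizes differ by 2m^2 + m, which is positive.\<close>
    ultimately show ?thesis using assms by simp
  qed
  then show ?thesis using dim_quotient nickel unfolding jennings by blast
qed

end
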